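(* Let $\Gamma$ be a distance-regular graph with classical parameters $(D,b,\alpha,\beta)$ such that $b\ge 2$ and $D\ge 3$, and let $r=[D]$. If $\beta \geq \frac{1}{3}(8\alpha b + 8b + 5\alpha)r$, then $\Gamma$ has the SPLS$(\lfloor \frac{4r}{3}\rfloor)$ property. In particular, in this case $\alpha$ is an integer with $0\le \alpha\le b$.
   Context: Distance-regular graph with intersection numbers $b_i,c_i$, valency $k=b_0$, $a_i = k-b_i-c_i$. For integer $b\ne 1$, $[j]=\frac{b^j-1}{b-1}$. Classical parameters $(D,b,\alpha,\beta)$ means diameter $D$, $b_i=([D]-[i])(\beta-\alpha[i])$ ($0\le i\le D-1$), $c_i=[i](1+\alpha[i-1])$ ($1\le i\le D$). A partial linear space is an incidence structure of points and lines in which any two distinct points lie on at most one common line; its point graph has the points as vertices, two distinct points adjacent iff they lie on a common line. For a partial linear space $X$, $\tau(X)$ is the maximum, over pairs of a point $x$ and a line $\ell$ not through $x$, of the number of points of $\ell$ collinear with $x$. For integers $c\ge 1$, $s\ge 2$, a distance-regular graph $\Gamma$ has the SPLS$(c,s)$ property if: $\Gamma$ is the point graph of a partial linear space $X=(V(\Gamma),\mathcal L,\in)$ where $\mathcal L$ is the set of all maximal cliques of $\Gamma$ with at least $a_1+2-(c-1)(s-1)$ vertices; $a_1\ge (2s-1)(c-1)$; each vertex lies on at most $s$ lines; and $\tau(X)\le c$. SPLS$(s)$ means SPLS$(c_2,s)$. *)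

theory Defs
  imports Complex_Main
begin

definition gdist :: "('a \<Rightarrow> 'a \<Rightarrow> bool) \<Rightarrow> 'a \<Rightarrow> 'a \<Rightarrow> nat" where
  "gdist E x y = (LEAST n. (E ^^ n) x y)"

definition sphere :: "'a set \<Rightarrow> ('a \<Rightarrow> 'a \<Rightarrow> bool) \<Rightarrow> nat \<Rightarrow> 'a \<Rightarrow> 'a set" where
  "sphere V E i x = {y \<in> V. gdist E x y = i}"

definition distance_regular ::
  "'a set \<Rightarrow> ('a \<Rightarrow> 'a \<Rightarrow> bool) \<Rightarrow> nat \<Rightarrow> (nat \<Rightarrow> nat) \<Rightarrow> (nat \<Rightarrow> nat) \<Rightarrow> bool" where
  "distance_regular V E D bi ci \<longleftrightarrow>
     finite V \<and> V \<noteq> {} \<and>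
     (\<forall>x y. E x y \<longrightarrow> x \<in> V \<and> y \<in> V) \<and>
     (\<forall>x y. E x y \<longrightarrow> E y x) \<and> (\<forall>x. \<not> E x x) \<and>
     (\<forall>x\<in>V. \<forall>y\<in>V. \<exists>n. (E ^^ n) x y) \<and>
     (\<exists>x\<in>V. \<exists>y\<in>V. gdist E x y = D) \<and>
     (\<forall>x\<in>V. \<forall>y\<in>V. gdist E x y \<le> D) \<and>
     (\<forall>i\<le>D. \<forall>x\<in>V. \<forall>y\<in>V. gdist E x y = i \<longrightarrow>
         card (sphere V E (i + 1) x \<inter> sphere V E 1 y) = bi i \<and>
         (1 \<le> i \<longrightarrow> card (sphere V E (i - 1) x \<inter> sphere V E 1 y) = ci i))"

text \<open>a_i = k - b_i - c_i, k = b_0 (c_0 = 0).\<close>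
definition a1 :: "(nat \<Rightarrow> nat) \<Rightarrow> (nat \<Rightarrow> nat) \<Rightarrow> int" where
  "a1 bi ci = int (bi 0) - int (bi 1) - int (ci 1)"

definition qnum :: "int \<Rightarrow> nat \<Rightarrow> real" where
  "qnum b j = (real_of_int b ^ j - 1) / (real_of_int b - 1)"

definition classical_parameters ::
  "(nat \<Rightarrow> nat) \<Rightarrow> (nat \<Rightarrow> nat) \<Rightarrow> nat \<Rightarrow> int \<Rightarrow> real \<Rightarrow> real \<Rightarrow> bool" where
  "classical_parameters bi ci D b \<alpha> \<beta> \<longleftrightarrow> b \<noteq> 1 \<and>
     (\<forall>i<D. real (bi i) = (qnum b D - qnum b i) * (\<beta> - \<alpha> * qnum b i)) \<and>
     (\<forall>i\<in>{1..D}. real (ci i) = qnum b i * (1 + \<alpha> * qnum b (i - 1)))"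

definition clique :: "'a set \<Rightarrow> ('a \<Rightarrow> 'a \<Rightarrow> bool) \<Rightarrow> 'a set \<Rightarrow> bool" where
  "clique V E C \<longleftrightarrow> C \<subseteq> V \<and> (\<forall>x\<in>C. \<forall>y\<in>C. x \<noteq> y \<longrightarrow> E x y)"

definition maximal_clique :: "'a set \<Rightarrow> ('a \<Rightarrow> 'a \<Rightarrow> bool) \<Rightarrow> 'a set \<Rightarrow> bool" where
  "maximal_clique V E C \<longleftrightarrow> clique V E C \<and> (\<forall>C'. clique V E C' \<and> C \<subseteq> C' \<longrightarrow> C' = C)"

definition SPLS ::
  "'a set \<Rightarrow> ('a \<Rightarrow> 'a \<Rightarrow> bool) \<Rightarrow> (nat \<Rightarrow> nat) \<Rightarrow> (nat \<Rightarrow> nat) \<Rightarrow> nat \<Rightarrow> nat \<Rightarrow> bool" where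
  "SPLS V E bi ci c s \<longleftrightarrow>
     (let L = {C. maximal_clique V E C \<and>
                  int (card C) \<ge> a1 bi ci + 2 - (int c - 1) * (int s - 1)} in
      c \<ge> 1 \<and> s \<ge> 2 \<and>
      (\<forall>x\<in>V. \<forall>y\<in>V. x \<noteq> y \<longrightarrow> card {l \<in> L. x \<in> l \<and> y \<in> l} \<le> 1) \<and>
      (\<forall>x\<in>V. \<forall>y\<in>V. x \<noteq> y \<longrightarrow> (E x y \<longleftrightarrow> (\<exists>l\<in>L. x \<in> l \<and> y \<in> l))) \<and>
      a1 bi ci \<ge> (2 * int s - 1) * (int c - 1) \<and>
      (\<forall>x\<in>V. card {l \<in> L. x \<in> l} \<le> s) \<and>
      (\<forall>x\<in>V. \<forall>l\<in>L. x \<notin> l \<longrightarrow> card {y \<in> l. E x y} \<le> c))"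

end

theory Submission
  imports "HOL-Analysis.Analysis" Defs
begin

text \<open>
  The lower bound on \<open>\<beta>\<close> excludes claws with more than \<open>s = \<lfloor>4r/3\<rfloor>\<close> leaves, by inclusion-exclusion in the
  neighbourhood of a vertex. Following Metsch, the common neighbours of the centre and one leaf of a
  maximum claw that miss the other leaves form a large clique; two large maximal cliques
  share at most one point, and a neighbour on none of these cliques would enlarge the claw.

  For the integrality of \<open>\<alpha>\<close>, the least eigenvalue of the graph is \<open>-r\<close>, so cliques have at most
  \<open>1 + \<beta>\<close> vertices, and every outside vertex adjacent to a clique that attains this bound has
  exactly \<open>1 + \<alpha>\<close> neighbours in it. There are fewer lines than points, so some nonzero vector sums
  to zero on all lines; it must be an eigenvector for \<open>-r\<close>, and all lines through its support attain
  the bound. Its support contains two vertices at distance 2, and counting their common neighbours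
  along lines gives \<open>1 + b\<close> lines carrying \<open>1 + \<alpha>\<close> points each, whence \<open>\<alpha> \<le> b\<close>.
\<close>

section \<open>Linear algebra on finite sets\<close>

text \<open>Gaussian elimination by induction on the equations: a pivot unknown of one equation is
  eliminated from all the others. This removes one equation and one unknown, so the strict
  inequality of cardinalities survives.\<close>

lemma exists_nonzero_kernel_vector:
  fixes a :: "'l \<Rightarrow> 'v \<Rightarrow> real"
  assumes "finite L" "finite V" "card L < card V"
  shows "\<exists>v. (\<exists>x\<in>V. v x \<noteq> 0) \<and> (\<forall>l\<in>L. (\<Sum>x\<in>V. a l x * v x) = 0)"
  using assms
proof (induction L arbitrary: V a rule: finite_induct)
  case empty
  then obtain x where "x \<in> V" by fastforce
  then show ?case by (intro exI[of _ "\<lambda>_. 1"]) auto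
next
  case (insert l L)
  show ?case
  proof (cases "\<exists>p\<in>V. a l p \<noteq> 0")
    case False
    obtain v where v: "\<exists>x\<in>V. v x \<noteq> 0" "\<forall>l\<in>L. (\<Sum>x\<in>V. a l x * v x) = 0"
      using insert.IH[of V a] insert.prems insert.hyps by auto
    then show ?thesis using False by (intro exI[of _ v]) auto
  next
    case True
    then obtain p where p: "p \<in> V" "a l p \<noteq> 0" by blast
    define W where "W = V - {p}"
    have W: "finite W" "V = insert p W" "p \<notin> W" "card L < card W"
      using insert p by (auto simp: W_def card_Diff_singleton)
    obtain v where v: "\<exists>x\<in>W. v x \<noteq> 0"
      "\<forall>m\<in>L. (\<Sum>x\<in>W. (a m x - a m p * a l x / a l p) * v x) = 0"
      using insert.IH[of W "\<lambda>m x. a m x - a m p * a l x / a l p"] W by blast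
    define S where "S = (\<Sum>x\<in>W. a l x * v x)"
    \<comment> \<open>The pivot coordinate gets the value that solves equation \<open>l\<close>; the
      reduced equations then say that the others hold too.\<close>
    define v' where "v' = v(p := - S / a l p)"
    have eqW: "(\<Sum>x\<in>W. a m x * v' x) = (\<Sum>x\<in>W. a m x * v x)" for m
      using W(3) by (intro sum.cong) (auto simp: v'_def)
    have "(\<Sum>x\<in>V. a m x * v' x) = (\<Sum>x\<in>W. a m x * v x) - a m p * S / a l p" for m
      using W eqW[of m] by (simp add: v'_def)
    moreover have "(\<Sum>x\<in>W. (a m x - a m p * a l x / a l p) * v x)
        = (\<Sum>x\<in>W. a m x * v x) - a m p * S / a l p" for m
      by (simp add: S_def left_diff_distrib sum_subtractf sum_distrib_left sum_divide_distrib mult.assoc)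
    ultimately have "\<forall>m\<in>insert l L. (\<Sum>x\<in>V. a m x * v' x) = 0"
      using v(2) p(2) by (auto simp: S_def)
    moreover have "\<exists>x\<in>V. v' x \<noteq> 0"
      using v(1) W by (auto simp: v'_def)
    ultimately show ?thesis by blast
  qed
qed

text \<open>A first-variation argument: for small \<open>t\<close> the linear term would dominate,
  so it must vanish.\<close>

lemma quadratic_nonneg_imp_linear_zero:
  fixes A B :: real
  assumes "\<And>t. 0 \<le> t\<^sup>2 * A + 2 * t * B" "0 \<le> A"
  shows "B = 0"
proof (rule ccontr)
  assume B: "B \<noteq> 0"
  \<comment> \<open>The quadratic is least at \<open>t = - B / A\<close>; the denominator
    \<open>A + 1\<close> also covers \<open>A = 0\<close>.\<close>
  have "0 \<le> (- B / (A + 1))\<^sup>2 * A + 2 * (- B / (A + 1)) * B" by (rule assms(1))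
  also have "\<dots> = (B\<^sup>2 / (A + 1)\<^sup>2) * (- A - 2)"
    using assms(2) by (simp add: divide_simps power2_eq_square) (simp add: algebra_simps)
  also have "\<dots> < 0" using assms(2) B by (intro mult_pos_neg) auto
  finally show False by simp
qed

text \<open>The form attains its minimum \<open>m\<close> on the compact unit sphere, and
  homogeneity extends this to the Rayleigh bound for all \<open>u\<close>. Perturbing a minimiser in
  the direction of its own residual shows that it is an eigenvector.\<close>

lemma symmetric_form_min_eigenvector:
  fixes a :: "'v \<Rightarrow> 'v \<Rightarrow> real"
  assumes fin: "finite V" and ne: "V \<noteq> {}" and sym: "\<And>x y. x \<in> V \<Longrightarrow> y \<in> V \<Longrightarrow> a x y = a y x"
  obtains m v where "\<exists>x\<in>V. v x \<noteq> 0" "\<And>x. x \<in> V \<Longrightarrow> (\<Sum>y\<in>V. a x y * v y) = m * v x"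
    "\<And>u. m * (\<Sum>x\<in>V. (u x)\<^sup>2) \<le> (\<Sum>x\<in>V. u x * (\<Sum>y\<in>V. a x y * u y))"
proof -
  define B where "B u w = (\<Sum>x\<in>V. u x * (\<Sum>y\<in>V. a x y * w y))" for u w :: "'v \<Rightarrow> real"
  define ip where "ip u w = (\<Sum>x\<in>V. u x * w x)" for u w :: "'v \<Rightarrow> real"
  \<comment> \<open>Vectors are functions on the whole type, so coordinates outside \<open>V\<close>
    are pinned to 0; the product is then compact by Tychonoff.\<close>
  define K where "K = PiE UNIV (\<lambda>x. if x \<in> V then {-1..1::real} else {0})"
  define S where "S = K \<inter> {v. (\<Sum>x\<in>V. (v x)\<^sup>2) = 1}"
  have "compactin (product_topology (\<lambda>_. euclidean) UNIV) K"
    unfolding K_def by (simp add: compactin_PiE)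
  then have cK: "compact K" by (simp add: euclidean_product_topology)
  have cont: "continuous_on UNIV (\<lambda>v::'v \<Rightarrow> real. v x)" for x
    by (rule continuous_on_product_coordinates)
  have "closed {v::'v \<Rightarrow> real. (\<Sum>x\<in>V. (v x)\<^sup>2) = 1}"
    by (intro closed_Collect_eq continuous_intros cont)
  then have cS: "compact S" unfolding S_def using cK by blast
  have contB: "continuous_on S (\<lambda>v. B v v)"
    unfolding B_def by (rule continuous_on_subset[of UNIV]) (intro continuous_intros cont, simp)
  have scaled: "(\<lambda>x. if x \<in> V then u x / sqrt N else 0) \<in> S" if N: "N = (\<Sum>x\<in>V. (u x)\<^sup>2)" "N > 0" for u N
  proof -
    have "(\<Sum>x\<in>V. (if x \<in> V then u x / sqrt N else 0)\<^sup>2) = (\<Sum>x\<in>V. (u x)\<^sup>2 / N)"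
      using N(2) by (intro sum.cong) (auto simp: power_divide)
    also have "\<dots> = 1" using N by (simp flip: sum_divide_distrib)
    moreover have "- sqrt N \<le> u x \<and> u x \<le> sqrt N" if "x \<in> V" for x
    proof -
      have "(u x)\<^sup>2 \<le> N" unfolding N(1) using that fin by (intro member_le_sum) auto
      then have "\<bar>u x\<bar> \<le> sqrt N" using real_sqrt_le_mono by fastforce
      then show ?thesis by linarith
    qed
    ultimately show ?thesis using N(2) unfolding S_def K_def
      by (auto simp: PiE_iff field_simps)
  qed
  obtain x0 where x0: "x0 \<in> V" using ne by blast
  have "(\<Sum>x\<in>V. (if x = x0 then 1 else 0::real)\<^sup>2) = (\<Sum>x\<in>V. if x = x0 then 1 else 0)"
    by (intro sum.cong) auto
  then have "(\<Sum>x\<in>V. (if x = x0 then 1 else 0::real)\<^sup>2) = 1" using x0 fin by simp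
  then have "S \<noteq> {}" using scaled[of 1 "\<lambda>x. if x = x0 then 1 else 0"] by auto
  then obtain v where v: "v \<in> S" "\<And>w. w \<in> S \<Longrightarrow> B v v \<le> B w w"
    using continuous_attains_inf[OF cS _ contB] by blast
  define m where "m = B v v"
  have vv: "ip v v = 1" using v(1) by (simp add: S_def ip_def power2_eq_square)
  have min: "m * ip u u \<le> B u u" for u
  proof (cases "ip u u = 0")
    case True
    then have "\<forall>x\<in>V. u x = 0" unfolding ip_def using fin by (subst (asm) sum_nonneg_eq_0_iff) auto
    then show ?thesis using True by (simp add: B_def)
  next
    case False
    define N where "N = ip u u"
    have N: "N = (\<Sum>x\<in>V. (u x)\<^sup>2)" by (simp add: N_def ip_def power2_eq_square)
    then have "N \<ge> 0" by (simp add: sum_nonneg)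
    then have N0: "N > 0" using False N_def by simp
    have "B (\<lambda>x. if x \<in> V then u x / sqrt N else 0) (\<lambda>x. if x \<in> V then u x / sqrt N else 0)
      = (\<Sum>x\<in>V. u x / sqrt N * (\<Sum>y\<in>V. a x y * (u y / sqrt N)))"
      unfolding B_def by (intro sum.cong refl) auto
    also have "\<dots> = B u u / (sqrt N * sqrt N)"
      unfolding B_def by (simp add: sum_divide_distrib sum_distrib_left mult.assoc)
    also have "\<dots> = B u u / N" using N0 by simp
    finally have "m \<le> B u u / N" using v(2)[OF scaled[OF N N0]] m_def by simp
    then show ?thesis using N0 by (simp add: field_simps N_def)
  qed
  \<comment> \<open>The residual of the eigenvalue equation. Along \<open>v + t * e\<close> the
    minimality of \<open>m\<close> gives a nonnegative quadratic in \<open>t\<close> whose linear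
    coefficient is \<open>ip e e\<close>, which forces the residual to vanish.\<close>
  define e where "e x = (\<Sum>y\<in>V. a x y * v y) - m * v x" for x
  have Bsym: "B u w = B w u" for u w
  proof -
    have "B u w = (\<Sum>x\<in>V. \<Sum>y\<in>V. u x * (a x y * w y))" by (simp add: B_def sum_distrib_left)
    also have "\<dots> = (\<Sum>y\<in>V. \<Sum>x\<in>V. u x * (a x y * w y))" by (rule sum.swap)
    also have "\<dots> = B w u" unfolding B_def sum_distrib_left
      by (intro sum.cong refl) (simp add: sym mult_ac)
    finally show ?thesis .
  qed
  have Badd: "B u (\<lambda>x. w x + t * z x) = B u w + t * B u z" for u w z t
    by (simp add: B_def algebra_simps sum.distrib sum_distrib_left)
  have ipadd: "ip u (\<lambda>x. w x + t * z x) = ip u w + t * ip u z" for u w z t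
    by (simp add: ip_def algebra_simps sum.distrib sum_distrib_left)
  have ipsym: "ip u w = ip w u" for u w by (simp add: ip_def mult.commute)
  have Bev: "B e v - m * ip e v = ip e e"
  proof -
    have "(\<Sum>y\<in>V. a x y * v y) = e x + m * v x" for x by (simp add: e_def)
    then have "B e v = (\<Sum>x\<in>V. e x * (e x + m * v x))" by (simp add: B_def)
    also have "\<dots> = ip e e + m * ip e v"
      by (simp add: ip_def distrib_left sum.distrib sum_distrib_left mult_ac)
    finally show ?thesis by simp
  qed
  have "0 \<le> t\<^sup>2 * (B e e - m * ip e e) + 2 * t * ip e e" for t
  proof -
    let ?w = "\<lambda>x. v x + t * e x"
    have "B ?w ?w = B ?w v + t * B ?w e" by (rule Badd)
    also have "\<dots> = B v v + t * B v e + t * (B e v + t * B e e)"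
      by (simp only: Bsym[of ?w] Badd)
    also have "\<dots> = m + 2 * t * B e v + t\<^sup>2 * B e e"
      by (simp add: m_def Bsym[of v e] power2_eq_square algebra_simps)
    finally have 1: "B ?w ?w = m + 2 * t * B e v + t\<^sup>2 * B e e" .
    have "ip ?w ?w = ip ?w v + t * ip ?w e" by (rule ipadd)
    also have "\<dots> = ip v v + t * ip v e + t * (ip e v + t * ip e e)"
      by (simp only: ipsym[of ?w] ipadd)
    also have "\<dots> = 1 + 2 * t * ip e v + t\<^sup>2 * ip e e"
      by (simp add: vv ipsym[of v e] power2_eq_square algebra_simps)
    finally have 2: "ip ?w ?w = 1 + 2 * t * ip e v + t\<^sup>2 * ip e e" .
    have "0 \<le> B ?w ?w - m * ip ?w ?w" using min by simp
    also have "\<dots> = t\<^sup>2 * (B e e - m * ip e e) + 2 * t * (B e v - m * ip e v)"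
      unfolding 1 2 by (simp add: algebra_simps)
    finally show ?thesis unfolding Bev .
  qed
  moreover have "0 \<le> B e e - m * ip e e" using min[of e] by simp
  ultimately have "ip e e = 0" by (rule quadratic_nonneg_imp_linear_zero)
  then have e0: "\<forall>x\<in>V. e x = 0" unfolding ip_def using fin by (subst (asm) sum_nonneg_eq_0_iff) auto
  have eig: "(\<Sum>y\<in>V. a x y * v y) = m * v x" if "x \<in> V" for x
    using bspec[OF e0 that] unfolding e_def by linarith
  have nz: "\<exists>x\<in>V. v x \<noteq> 0"
  proof (rule ccontr)
    assume "\<not> ?thesis"
    then have "ip v v = 0" by (simp add: ip_def)
    then show False using vv by simp
  qed
  have "m * (\<Sum>x\<in>V. (u x)\<^sup>2) \<le> (\<Sum>x\<in>V. u x * (\<Sum>y\<in>V. a x y * u y))" for u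
    using min[of u] unfolding B_def ip_def power2_eq_square .
  then show ?thesis using that[OF nz eig] by blast
qed

section \<open>Distance-regular graphs\<close>

locale drg =
  fixes V :: "'a set" and E :: "'a \<Rightarrow> 'a \<Rightarrow> bool" and D :: nat and bi ci :: "nat \<Rightarrow> nat"
  assumes dr: "distance_regular V E D bi ci"
begin

abbreviation dst :: "'a \<Rightarrow> 'a \<Rightarrow> nat" where "dst \<equiv> gdist E"

abbreviation nbrs :: "'a \<Rightarrow> 'a set" where "nbrs y \<equiv> {z. E y z}"

text \<open>\<open>distance_regular\<close> says nothing about \<open>ci 0\<close>; the usual
  convention that it is 0 is built in here.\<close>

definition cc :: "nat \<Rightarrow> real" where "cc i = (if i = 0 then 0 else real (ci i))"

definition aa :: "nat \<Rightarrow> real" where "aa i = real (bi 0) - real (bi i) - cc i"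

lemma finV [simp]: "finite V" and V_ne: "V \<noteq> {}"
  and edge_in: "E x y \<Longrightarrow> x \<in> V" "E x y \<Longrightarrow> y \<in> V"
  and edge_sym: "E x y \<Longrightarrow> E y x" and edge_irrefl [simp]: "\<not> E x x"
  and connected: "x \<in> V \<Longrightarrow> y \<in> V \<Longrightarrow> \<exists>n. (E ^^ n) x y"
  and diameter_attained: "\<exists>x\<in>V. \<exists>y\<in>V. dst x y = D"
  and dst_le_D: "x \<in> V \<Longrightarrow> y \<in> V \<Longrightarrow> dst x y \<le> D"
  using dr unfolding distance_regular_def by blast+

lemma finite_nbrs [simp]: "finite (nbrs y)"
  by (rule finite_subset[OF _ finV]) (auto dest: edge_in)

lemma dst_le: "(E ^^ n) x y \<Longrightarrow> dst x y \<le> n"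
  unfolding gdist_def by (rule Least_le)

lemma walk_dst: "x \<in> V \<Longrightarrow> y \<in> V \<Longrightarrow> (E ^^ dst x y) x y"
  unfolding gdist_def using connected by (rule LeastI_ex)

lemma dst_self [simp]: "dst x x = 0"
  using dst_le[of 0 x x] by simp

lemma dst_eq_0: "x \<in> V \<Longrightarrow> y \<in> V \<Longrightarrow> dst x y = 0 \<longleftrightarrow> x = y"
  using walk_dst[of x y] by auto

lemma dst_eq_1: assumes "x \<in> V" "y \<in> V" shows "dst x y = 1 \<longleftrightarrow> E x y"
proof
  assume "dst x y = 1" then show "E x y" using walk_dst[OF assms] by (simp add: relcompp_apply)
next
  assume e: "E x y"
  then have "(E ^^ 1) x y" by (simp add: relcompp_apply)
  then have "dst x y \<le> 1" by (rule dst_le)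
  moreover have "dst x y \<noteq> 0" using e assms by (auto simp: dst_eq_0)
  ultimately show "dst x y = 1" by simp
qed

lemma dst_step: assumes "x \<in> V" "E y z" shows "dst x z \<le> Suc (dst x y)"
  using relpowp_Suc_I[OF walk_dst[OF assms(1) edge_in(1)[OF assms(2)]] assms(2)] by (rule dst_le)

lemma dst_step': assumes "x \<in> V" "E y z" shows "dst x y \<le> Suc (dst x z)"
  using assms edge_sym dst_step by blast

lemma walk_sym: "(E ^^ n) x y \<Longrightarrow> (E ^^ n) y x"
proof (induction n arbitrary: x y)
  case (Suc n)
  then obtain z where "(E ^^ n) x z" "E z y" by (elim relpowp_Suc_E)
  then show ?case using Suc.IH edge_sym by (intro relpowp_Suc_I2) auto
qed auto

lemma dst_commute: "dst x y = dst y x"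
proof -
  have "(E ^^ n) x y \<longleftrightarrow> (E ^^ n) y x" for n using walk_sym by blast
  then show ?thesis by (simp add: gdist_def)
qed

lemma dst_predecessor:
  assumes "x \<in> V" "y \<in> V" "dst x y = Suc i"
  shows "\<exists>z. E z y \<and> dst x z = i"
proof -
  have "(E ^^ Suc i) x y" using walk_dst[OF assms(1,2)] assms(3) by simp
  then obtain z where z: "(E ^^ i) x z" "E z y" by (elim relpowp_Suc_E)
  have "dst x z \<le> i" using z(1) by (rule dst_le)
  moreover have "Suc i \<le> Suc (dst x z)" using dst_step[OF assms(1) z(2)] assms(3) by simp
  ultimately show ?thesis using z by auto
qed

text \<open>Walks back along a geodesic of full length, hence the downward induction from
  \<open>D\<close>.\<close>

lemma exists_at_dst: assumes "i \<le> D" shows "\<exists>x\<in>V. \<exists>y\<in>V. dst x y = i"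
  using assms
proof (induction rule: inc_induct)
  case base then show ?case by (rule diameter_attained)
next
  case (step n) then show ?case using dst_predecessor edge_in by blast
qed

lemma sphere_1: "y \<in> V \<Longrightarrow> sphere V E 1 y = nbrs y"
  using dst_eq_1 by (auto simp: Defs.sphere_def dest: edge_in)

lemma intersection_numbers:
  assumes "x \<in> V" "y \<in> V"
  shows "card (sphere V E (dst x y + 1) x \<inter> sphere V E 1 y) = bi (dst x y)"
    and "1 \<le> dst x y \<Longrightarrow> card (sphere V E (dst x y - 1) x \<inter> sphere V E 1 y) = ci (dst x y)"
proof -
  have "\<forall>i\<le>D. \<forall>x\<in>V. \<forall>y\<in>V. dst x y = i \<longrightarrow>
         card (sphere V E (i + 1) x \<inter> sphere V E 1 y) = bi i \<and>
         (1 \<le> i \<longrightarrow> card (sphere V E (i - 1) x \<inter> sphere V E 1 y) = ci i)"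
    using dr unfolding distance_regular_def by (elim conjE) assumption
  from this[rule_format, OF dst_le_D[OF assms] assms refl]
  show "card (sphere V E (dst x y + 1) x \<inter> sphere V E 1 y) = bi (dst x y)"
    and "1 \<le> dst x y \<Longrightarrow> card (sphere V E (dst x y - 1) x \<inter> sphere V E 1 y) = ci (dst x y)"
    by blast+
qed

lemma card_nbrs_outer:
  assumes "x \<in> V" "y \<in> V" shows "card {z \<in> nbrs y. dst x z = Suc (dst x y)} = bi (dst x y)"
proof -
  have "{z \<in> nbrs y. dst x z = Suc (dst x y)} = sphere V E (dst x y + 1) x \<inter> sphere V E 1 y"
    unfolding sphere_1[OF assms(2)] by (auto simp: Defs.sphere_def dest: edge_in)
  then show ?thesis using intersection_numbers(1)[OF assms] by simp
qed

lemma card_nbrs_inner: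
  assumes "x \<in> V" "y \<in> V" shows "real (card {z \<in> nbrs y. Suc (dst x z) = dst x y}) = cc (dst x y)"
proof (cases "dst x y = 0")
  case False
  have "{z \<in> nbrs y. Suc (dst x z) = dst x y} = sphere V E (dst x y - 1) x \<inter> sphere V E 1 y"
    unfolding sphere_1[OF assms(2)] using False by (auto simp: Defs.sphere_def dest: edge_in)
  then show ?thesis using intersection_numbers(2)[OF assms] False by (simp add: cc_def)
qed (simp add: cc_def)

lemma card_nbrs: assumes "y \<in> V" shows "card (nbrs y) = bi 0"
proof -
  have "{z \<in> nbrs y. dst y z = Suc (dst y y)} = nbrs y"
    using dst_eq_1 assms by (auto dest: edge_in)
  then show ?thesis using card_nbrs_outer[OF assms assms] by simp
qed

lemma nbrs_split:
  assumes "x \<in> V" "y \<in> V"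
  shows "(\<Sum>z\<in>nbrs y. g z) = (\<Sum>z\<in>{z \<in> nbrs y. Suc (dst x z) = dst x y}. g z)
     + (\<Sum>z\<in>{z \<in> nbrs y. dst x z = dst x y}. g z)
     + (\<Sum>z\<in>{z \<in> nbrs y. dst x z = Suc (dst x y)}. g z :: real)"
proof -
  have "z \<in> nbrs y \<Longrightarrow> Suc (dst x z) = dst x y \<or> dst x z = dst x y \<or> dst x z = Suc (dst x y)" for z
    using dst_step[OF assms(1), of y z] dst_step'[OF assms(1), of y z] by auto
  then have "(\<Sum>z\<in>nbrs y. g z) = sum g ({z \<in> nbrs y. Suc (dst x z) = dst x y} \<union> {z \<in> nbrs y. dst x z = dst x y}
     \<union> {z \<in> nbrs y. dst x z = Suc (dst x y)})" by (intro sum.cong) auto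
  also have "\<dots> = sum g ({z \<in> nbrs y. Suc (dst x z) = dst x y} \<union> {z \<in> nbrs y. dst x z = dst x y})
     + sum g {z \<in> nbrs y. dst x z = Suc (dst x y)}"
    by (intro sum.union_disjoint) auto
  also have "sum g ({z \<in> nbrs y. Suc (dst x z) = dst x y} \<union> {z \<in> nbrs y. dst x z = dst x y})
     = sum g {z \<in> nbrs y. Suc (dst x z) = dst x y} + sum g {z \<in> nbrs y. dst x z = dst x y}"
    by (intro sum.union_disjoint) auto
  finally show ?thesis .
qed

lemma card_nbrs_level:
  assumes "x \<in> V" "y \<in> V" shows "real (card {z \<in> nbrs y. dst x z = dst x y}) = aa (dst x y)"
  using nbrs_split[OF assms, of "\<lambda>_. 1"] card_nbrs[OF assms(2)] card_nbrs_inner[OF assms]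
    card_nbrs_outer[OF assms] by (simp add: aa_def)

text \<open>One row of the three-term recurrence of the graph. At \<open>i = 0\<close> the truncated
  \<open>i - 1\<close> is harmless because \<open>cc 0 = 0\<close>.\<close>

lemma sum_nbrs_radial:
  assumes "x \<in> V" "y \<in> V" "dst x y = i"
  shows "(\<Sum>z\<in>nbrs y. g (dst x z)) = cc i * g (i - 1) + aa i * g i + real (bi i) * (g (Suc i) :: real)"
proof -
  have "(\<Sum>z\<in>{z \<in> nbrs y. Suc (dst x z) = dst x y}. g (dst x z)) = (\<Sum>z\<in>{z \<in> nbrs y. Suc (dst x z) = dst x y}. g (i - 1))"
    using assms(3) by (intro sum.cong refl) (metis (mono_tags, lifting) diff_Suc_1 mem_Collect_eq)
  moreover have "(\<Sum>z\<in>{z \<in> nbrs y. dst x z = dst x y}. g (dst x z)) = (\<Sum>z\<in>{z \<in> nbrs y. dst x z = dst x y}. g i)"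
    using assms(3) by (intro sum.cong) auto
  moreover have "(\<Sum>z\<in>{z \<in> nbrs y. dst x z = Suc (dst x y)}. g (dst x z)) = (\<Sum>z\<in>{z \<in> nbrs y. dst x z = Suc (dst x y)}. g (Suc i))"
    using assms(3) by (intro sum.cong) auto
  ultimately show ?thesis
    using nbrs_split[OF assms(1,2), of "\<lambda>z. g (dst x z)"] card_nbrs_inner[OF assms(1,2)]
      card_nbrs_outer[OF assms(1,2)] card_nbrs_level[OF assms(1,2)] assms(3) by simp
qed

text \<open>Classical parameters prescribe \<open>bi i\<close> only for \<open>i < D\<close>; this
  supplies the last value.\<close>

lemma bi_D: "bi D = 0"
proof -
  obtain x y where xy: "x \<in> V" "y \<in> V" "dst x y = D" using diameter_attained by blast
  have "{z \<in> nbrs y. dst x z = Suc (dst x y)} = {}"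
    using dst_le_D[OF xy(1)] xy(3) by (fastforce dest: edge_in)
  then show ?thesis using card_nbrs_outer[OF xy(1,2)] unfolding xy(3) by (metis card.empty)
qed

lemma ci_pos: assumes "1 \<le> i" "i \<le> D" shows "0 < ci i"
proof -
  obtain x y where xy: "x \<in> V" "y \<in> V" "dst x y = i" using exists_at_dst assms by blast
  then obtain z where "E z y" "Suc (dst x z) = i"
    using dst_predecessor[of x y "i - 1"] assms by auto
  then have "{z \<in> nbrs y. Suc (dst x z) = dst x y} \<noteq> {}" using xy edge_sym by auto
  then have "0 < real (card {z \<in> nbrs y. Suc (dst x z) = dst x y})" by (simp add: card_gt_0_iff)
  then show ?thesis unfolding card_nbrs_inner[OF xy(1,2)] using xy(3) assms by (simp add: cc_def)
qed

text \<open>This is the \<open>i\<close>-th distance matrix of the graph applied to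
  \<open>f\<close>, read at \<open>x\<close>.\<close>

definition shell_sum :: "nat \<Rightarrow> ('a \<Rightarrow> real) \<Rightarrow> 'a \<Rightarrow> real" where
  "shell_sum i f x = (\<Sum>y\<in>V. if dst x y = i then f y else 0)"

lemma sum_nbrs_eq: "y \<in> V \<Longrightarrow> (\<Sum>z\<in>nbrs y. f z) = (\<Sum>z\<in>V. if E y z then f z else (0::real))"
  by (intro sum.mono_neutral_cong_left) (auto dest: edge_in)

lemma shell_sum_0: "x \<in> V \<Longrightarrow> shell_sum 0 f x = f x"
proof -
  assume x: "x \<in> V"
  have "shell_sum 0 f x = (\<Sum>y\<in>V. if y = x then f y else 0)"
    unfolding shell_sum_def using x by (intro sum.cong) (auto simp: dst_eq_0)
  then show ?thesis using x by simp
qed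

lemma shell_sum_beyond: "x \<in> V \<Longrightarrow> D < i \<Longrightarrow> shell_sum i f x = 0"
  unfolding shell_sum_def using dst_le_D by (intro sum.neutral) fastforce

lemma sum_radial_mult:
  assumes "x \<in> V"
  shows "(\<Sum>z\<in>V. g (dst x z) * f z) = (\<Sum>i\<le>D. g i * shell_sum i f x)"
proof -
  have "(\<Sum>i\<le>D. g i * shell_sum i f x) = (\<Sum>i\<le>D. \<Sum>z\<in>V. if dst x z = i then g (dst x z) * f z else 0)"
    unfolding shell_sum_def sum_distrib_left by (intro sum.cong) auto
  also have "\<dots> = (\<Sum>z\<in>V. \<Sum>i\<le>D. if dst x z = i then g (dst x z) * f z else 0)"
    by (rule sum.swap)
  also have "\<dots> = (\<Sum>z\<in>V. g (dst x z) * f z)"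
    using dst_le_D[OF assms] by (intro sum.cong) auto
  finally show ?thesis by simp
qed

lemma sum_edges_swap:
  fixes f g :: "'a \<Rightarrow> real"
  shows "(\<Sum>x\<in>V. g x * (\<Sum>z\<in>nbrs x. f z)) = (\<Sum>z\<in>V. f z * (\<Sum>x\<in>nbrs z. g x))"
proof -
  have "(\<Sum>x\<in>V. g x * (\<Sum>z\<in>nbrs x. f z)) = (\<Sum>x\<in>V. \<Sum>z\<in>V. if E x z then g x * f z else 0)"
    by (intro sum.cong refl) (auto simp: sum_nbrs_eq sum_distrib_left intro!: sum.cong)
  also have "\<dots> = (\<Sum>z\<in>V. \<Sum>x\<in>V. if E x z then g x * f z else 0)" by (rule sum.swap)
  also have "\<dots> = (\<Sum>z\<in>V. f z * (\<Sum>x\<in>nbrs z. g x))"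
    by (intro sum.cong refl) (auto simp: sum_nbrs_eq sum_distrib_left intro!: sum.cong dest: edge_sym)
  finally show ?thesis .
qed

text \<open>Expands a distance matrix times the adjacency matrix in distance matrices. Symmetry
  moves the neighbour sum from \<open>f\<close> onto the indicator of the shell, where the radial
  expansion applies.\<close>

lemma shell_sum_recurrence:
  assumes x: "x \<in> V"
  shows "shell_sum i (\<lambda>y. \<Sum>z\<in>nbrs y. f z) x
    = cc (Suc i) * shell_sum (Suc i) f x + aa i * shell_sum i f x
      + (if i = 0 then 0 else real (bi (i - 1)) * shell_sum (i - 1) f x)"
proof -
  have "shell_sum i (\<lambda>y. \<Sum>z\<in>nbrs y. f z) x
      = (\<Sum>y\<in>V. (if dst x y = i then 1 else 0) * (\<Sum>z\<in>nbrs y. f z))"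
    unfolding shell_sum_def by (intro sum.cong) auto
  also have "\<dots> = (\<Sum>z\<in>V. f z * (\<Sum>y\<in>nbrs z. if dst x y = i then 1 else 0))"
    by (rule sum_edges_swap)
  also have "\<dots> = (\<Sum>z\<in>V. cc (Suc i) * (if dst x z = Suc i then f z else 0)
      + aa i * (if dst x z = i then f z else 0)
      + (if i = 0 then 0 else real (bi (i - 1)) * (if dst x z = i - 1 then f z else 0)))"
    using sum_nbrs_radial[OF x, of _ _ "\<lambda>j. if j = i then 1 else 0"]
    by (intro sum.cong refl) (auto simp: cc_def)
  also have "\<dots> = cc (Suc i) * shell_sum (Suc i) f x + aa i * shell_sum i f x
      + (if i = 0 then 0 else real (bi (i - 1)) * shell_sum (i - 1) f x)"
    by (auto simp: shell_sum_def sum.distrib sum_distrib_left)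
  finally show ?thesis .
qed

end

section \<open>The least eigenvalue and Delsarte cliques\<close>

locale classical_drg = drg +
  fixes b :: int and \<alpha> \<beta> :: real
  assumes classical: "classical_parameters bi ci D b \<alpha> \<beta>"
    and b_ge: "b \<ge> 2" and D_ge: "D \<ge> 3"
    and beta_large: "\<beta> \<ge> (1/3) * (8 * \<alpha> * b + 8 * b + 5 * \<alpha>) * qnum b D"
begin

abbreviation q :: "nat \<Rightarrow> real" where "q \<equiv> qnum b"
abbreviation r :: real where "r \<equiv> qnum b D"

lemma q_0 [simp]: "q 0 = 0" and q_1 [simp]: "q (Suc 0) = 1"
  using b_ge by (auto simp: qnum_def)

lemma q_Suc: "q (Suc i) = q i + real_of_int b ^ i"
  using b_ge by (simp add: qnum_def field_simps)

lemma q_2: "q 2 = b + 1"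
  using q_Suc[of 1] by (simp add: numeral_2_eq_2)

lemma q_3: "q 3 = b\<^sup>2 + b + 1"
  using q_Suc[of 2] q_2 by (simp add: eval_nat_numeral)

lemma q_mono: "i \<le> j \<Longrightarrow> q i \<le> q j"
  by (rule lift_Suc_mono_le) (use b_ge in \<open>auto simp: q_Suc\<close>)

lemma q_strict_mono: "i < j \<Longrightarrow> q i < q j"
  by (rule lift_Suc_mono_less) (use b_ge in \<open>auto simp: q_Suc\<close>)

lemma q_nonneg: "0 \<le> q i"
  using q_mono[of 0 i] by simp

lemma r_ge_7: "7 \<le> r"
proof -
  have "b\<^sup>2 \<ge> 2\<^sup>2" using b_ge by (intro power_mono) auto
  then have "b\<^sup>2 + b + 1 \<ge> 7" using b_ge by simp
  then have "real_of_int (b\<^sup>2 + b + 1) \<ge> 7" by linarith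
  then show ?thesis using q_mono[OF D_ge] q_3 by simp
qed

lemma cc_eq: "i \<le> D \<Longrightarrow> cc i = q i * (1 + \<alpha> * q (i - 1))"
  using classical by (auto simp: classical_parameters_def cc_def)

lemma bi_eq: "i \<le> D \<Longrightarrow> real (bi i) = (r - q i) * (\<beta> - \<alpha> * q i)"
  using classical bi_D by (cases "i = D") (auto simp: classical_parameters_def)

lemma ci_2: "real (ci 2) = (1 + b) * (1 + \<alpha>)"
  using cc_eq[of 2] D_ge q_2 by (simp add: cc_def algebra_simps)

text \<open>Integrality of \<open>ci 2\<close> makes \<open>\<alpha> * (b + 1)\<close> an integer
  \<open>n\<close>; then \<open>ci 3 > 0\<close> forces \<open>1 + n > 0\<close>, that is
  \<open>n \<ge> 0\<close>. The bound \<open>D \<ge> 3\<close> enters through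
  \<open>ci 3\<close>.\<close>

lemma alpha_nonneg: "0 \<le> \<alpha>"
proof -
  define n where "n = int (ci 2) - 1 - b"
  have n: "real_of_int n = \<alpha> * (b + 1)" using ci_2 by (simp add: n_def algebra_simps)
  have "0 < cc 3" using ci_pos[of 3] D_ge by (simp add: cc_def)
  then have "0 < q 3 * (1 + n)" using cc_eq[of 3] D_ge q_2 n by (simp add: numeral_3_eq_3 numeral_2_eq_2)
  then have "0 < 1 + n" using q_nonneg[of 3] by (auto simp: zero_less_mult_iff)
  then have "0 \<le> real_of_int n" by simp
  then show ?thesis using n b_ge by (simp add: zero_le_mult_iff)
qed

text \<open>A crude form of the hypothesis on \<beta>, enough to make all factors
  \<open>\<beta> - \<alpha> * q i\<close> positive.\<close>

lemma beta_gt: "\<alpha> * r + 16 / 3 * r \<le> \<beta>"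
proof -
  have "real_of_int b \<ge> 2" using b_ge by simp
  then have "2 * \<alpha> \<le> b * \<alpha>" using alpha_nonneg by (intro mult_right_mono) auto
  then have "3 * \<alpha> + 16 \<le> 8 * \<alpha> * b + 8 * b + 5 * \<alpha>"
    using b_ge alpha_nonneg \<open>real_of_int b \<ge> 2\<close> by (simp add: algebra_simps)
  then have "(3 * \<alpha> + 16) * r \<le> (8 * \<alpha> * b + 8 * b + 5 * \<alpha>) * r"
    using q_nonneg[of D] by (rule mult_right_mono)
  then show ?thesis using beta_large by (simp add: algebra_simps)
qed

lemma beta_alpha_pos: assumes "i \<le> D" shows "0 < \<beta> - \<alpha> * q i"
proof -
  have "\<alpha> * q i \<le> \<alpha> * r" using alpha_nonneg q_mono[OF assms] by (rule mult_left_mono[rotated])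
  then show ?thesis using beta_gt r_ge_7 by simp
qed

lemma beta_pos: "0 < \<beta>"
  using beta_alpha_pos[of 0] by simp

lemma one_alpha_pos: "0 < 1 + \<alpha> * q i"
  using alpha_nonneg q_nonneg[of i] by (simp add: add_pos_nonneg)

lemma cc_Suc_pos: "i < D \<Longrightarrow> 0 < cc (Suc i)"
  using cc_eq[of "Suc i"] one_alpha_pos[of i] q_strict_mono[of 0 "Suc i"] by simp

text \<open>For an eigenvector to \<open>-r\<close>, consecutive shell sums satisfy
  \<open>cc (Suc i) * W (Suc i) = - \<rho> i * W i\<close>; the factor vanishes at
  \<open>i = D\<close>.\<close>

definition \<rho> :: "nat \<Rightarrow> real" where "\<rho> i = (r - q i) * (1 + \<alpha> * q i)"

lemma rho_pos: "i < D \<Longrightarrow> 0 < \<rho> i"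
  using one_alpha_pos[of i] q_strict_mono[of i D] by (simp add: \<rho>_def)

text \<open>The characteristic recurrence at \<open>-r\<close> factors into first-order recurrences because of this identity.\<close>

lemma aa_plus_r: assumes "i \<le> D" shows "aa i + r = q i * (\<beta> - \<alpha> * q (i - 1)) + \<rho> i"
proof -
  have "aa i = r * \<beta> - (r - q i) * (\<beta> - \<alpha> * q i) - q i * (1 + \<alpha> * q (i - 1))"
    using assms bi_eq[of 0] bi_eq[of i] cc_eq[of i] by (simp add: aa_def)
  then show ?thesis by (simp add: \<rho>_def algebra_simps)
qed

lemma shell_sum_eigen:
  assumes x: "x \<in> V" and eig: "\<And>y. y \<in> V \<Longrightarrow> (\<Sum>z\<in>nbrs y. v z) = \<theta> * v y"
  shows "cc (Suc i) * shell_sum (Suc i) v x = (\<theta> - aa i) * shell_sum i v x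
      - (if i = 0 then 0 else real (bi (i - 1)) * shell_sum (i - 1) v x)"
proof -
  have "shell_sum i (\<lambda>y. \<Sum>z\<in>nbrs y. v z) x = \<theta> * shell_sum i v x"
    unfolding shell_sum_def sum_distrib_left by (intro sum.cong refl) (auto simp: eig)
  then show ?thesis using shell_sum_recurrence[OF x, of i v] by (simp add: algebra_simps)
qed

text \<open>If \<theta> were below \<open>-r\<close>, the shell sums with alternating signs would
  grow strictly faster than the first-order recurrence at \<open>-r\<close> prescribes and could
  never vanish, yet the shell beyond \<open>D\<close> is empty.\<close>

lemma eigenvalue_ge:
  assumes nz: "\<exists>x\<in>V. v x \<noteq> 0" and eig: "\<And>y. y \<in> V \<Longrightarrow> (\<Sum>z\<in>nbrs y. v z) = \<theta> * v y"
  shows "- r \<le> \<theta>"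
proof (rule ccontr)
  assume "\<not> ?thesis"
  then have th: "\<theta> < - r" by simp
  obtain x where x: "x \<in> V" "v x \<noteq> 0" using nz by blast
  define P where "P i = (-1) ^ i * shell_sum i v x / v x" for i
  have P0: "P 0 = 1" using x shell_sum_0 by (simp add: P_def)
  have rec0: "cc 1 * P 1 = (aa 0 - \<theta>) * P 0"
    using shell_sum_eigen[OF x(1) eig, of 0] x(2) by (simp add: P_def field_simps)
  have recS: "cc (Suc (Suc i)) * P (Suc (Suc i)) = (aa (Suc i) - \<theta>) * P (Suc i) - bi i * P i" for i
  proof -
    have e: "cc (Suc (Suc i)) * shell_sum (Suc (Suc i)) v x
        = (\<theta> - aa (Suc i)) * shell_sum (Suc i) v x - bi i * shell_sum i v x"
      using shell_sum_eigen[OF x(1) eig, of "Suc i"] by simp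
    have "cc (Suc (Suc i)) * P (Suc (Suc i))
        = (-1) ^ i * (cc (Suc (Suc i)) * shell_sum (Suc (Suc i)) v x) / v x"
      by (simp add: P_def)
    also have "\<dots> = (aa (Suc i) - \<theta>) * P (Suc i) - bi i * P i"
      unfolding e by (simp add: P_def diff_divide_distrib left_diff_distrib right_diff_distrib mult_ac)
    finally show ?thesis .
  qed
  \<comment> \<open>The comparison with \<open>\<rho>\<close>, not positivity alone, carries the
    induction: after cancelling \<open>1 + \<alpha> * q i\<close> it bounds the subtracted term
    \<open>bi i * P i\<close> by the first summand of \<open>aa (Suc i) + r\<close>, times
    \<open>P (Suc i)\<close>.\<close>
  have "i \<le> D \<Longrightarrow> 0 < P i \<and> \<rho> i * P i < cc (Suc i) * P (Suc i)" for i
  proof (induction i)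
    case 0
    have "\<rho> 0 = aa 0 + r" using aa_plus_r[of 0] by simp
    then show ?case using rec0 P0 th by simp
  next
    case (Suc i)
    then have IH: "0 < P i" "\<rho> i * P i < cc (Suc i) * P (Suc i)" and iD: "i < D" by auto
    have ar: "aa (Suc i) + r = q (Suc i) * (\<beta> - \<alpha> * q i) + \<rho> (Suc i)"
      using aa_plus_r[of "Suc i"] iD by simp
    have "0 < \<rho> i * P i" using IH rho_pos[OF iD] by simp
    then have "0 < cc (Suc i) * P (Suc i)" using IH(2) by linarith
    then have pos: "0 < P (Suc i)" using cc_Suc_pos[OF iD] by (simp add: zero_less_mult_iff)
    have "(1 + \<alpha> * q i) * ((r - q i) * P i) \<le> (1 + \<alpha> * q i) * (q (Suc i) * P (Suc i))"
      using IH(2) cc_eq[of "Suc i"] iD by (simp add: \<rho>_def mult_ac)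
    then have "(r - q i) * P i \<le> q (Suc i) * P (Suc i)" using one_alpha_pos[of i] by simp
    then have "(\<beta> - \<alpha> * q i) * ((r - q i) * P i) \<le> (\<beta> - \<alpha> * q i) * (q (Suc i) * P (Suc i))"
      using beta_alpha_pos[of i] iD by (intro mult_left_mono) auto
    moreover have "(\<beta> - \<alpha> * q i) * ((r - q i) * P i) = bi i * P i"
      using bi_eq[of i] iD by (simp add: mult_ac)
    moreover have "(aa (Suc i) + r) * P (Suc i)
        = (\<beta> - \<alpha> * q i) * (q (Suc i) * P (Suc i)) + \<rho> (Suc i) * P (Suc i)"
      unfolding ar by (simp add: algebra_simps)
    moreover have "(aa (Suc i) + r) * P (Suc i) < (aa (Suc i) - \<theta>) * P (Suc i)"
      using th pos by simp
    ultimately have "\<rho> (Suc i) * P (Suc i) < cc (Suc (Suc i)) * P (Suc (Suc i))"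
      using recS[of i] by linarith
    then show ?case using pos by simp
  qed
  \<comment> \<open>At \<open>i = D\<close> both sides of the strict inequality are 0.\<close>
  from this[of D] show False using shell_sum_beyond[OF x(1), of "Suc D" v] by (simp add: \<rho>_def P_def)
qed

text \<open>The adjacency matrix plus \<open>r\<close> times the identity is positive semidefinite:
  the minimum of the form is an eigenvalue, to which \<open>eigenvalue_ge\<close> applies.\<close>

lemma adjacency_form_ge:
  "- r * (\<Sum>x\<in>V. (u x)\<^sup>2) \<le> (\<Sum>x\<in>V. u x * (\<Sum>z\<in>nbrs x. u z))"
proof -
  define a where "a x y = (if E x y then 1 else 0 :: real)" for x y
  have nb: "(\<Sum>y\<in>V. a x y * w y) = (\<Sum>z\<in>nbrs x. w z)" if "x \<in> V" for x and w :: "'a \<Rightarrow> real"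
    unfolding sum_nbrs_eq[OF that] a_def by (intro sum.cong) auto
  have asym: "a x y = a y x" for x y using edge_sym[of x y] edge_sym[of y x] by (auto simp: a_def)
  obtain m v where m: "\<exists>x\<in>V. v x \<noteq> 0"
    "\<And>x. x \<in> V \<Longrightarrow> (\<Sum>y\<in>V. a x y * v y) = m * v x"
    "\<And>u. m * (\<Sum>x\<in>V. (u x)\<^sup>2) \<le> (\<Sum>x\<in>V. u x * (\<Sum>y\<in>V. a x y * u y))"
    by (rule symmetric_form_min_eigenvector[OF finV V_ne, of a, OF asym]) (rule that, assumption+)
  have "- r \<le> m" using m(1)
  proof (rule eigenvalue_ge)
    fix y assume "y \<in> V"
    then show "(\<Sum>z\<in>nbrs y. v z) = m * v y" using m(2)[of y] nb[of y v] by simp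
  qed
  then have "- r * (\<Sum>x\<in>V. (u x)\<^sup>2) \<le> m * (\<Sum>x\<in>V. (u x)\<^sup>2)"
    by (intro mult_right_mono) (auto simp: sum_nonneg)
  also have "\<dots> \<le> (\<Sum>x\<in>V. u x * (\<Sum>z\<in>nbrs x. u z))"
    using m(3)[of u] nb by simp
  finally show ?thesis .
qed

section \<open>Projection onto the eigenspace of \<open>-r\<close>\<close>

primrec uu :: "nat \<Rightarrow> real" where
  "uu 0 = 1"
| "uu (Suc i) = - ((1 + \<alpha> * q i) / (\<beta> - \<alpha> * q i) * uu i)"

text \<open>While \<open>uu\<close> is the standard (cosine) sequence of \<open>-r\<close>, with
  \<open>uu 1 = - 1 / \<beta>\<close>, the number \<open>pp i\<close> is the eigenvalue of the
  \<open>i\<close>-th distance matrix on the same eigenspace.\<close>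

primrec pp :: "nat \<Rightarrow> real" where
  "pp 0 = 1"
| "pp (Suc i) = - (\<rho> i / cc (Suc i) * pp i)"

text \<open>Both recursions flip the sign at every step, so the signs cancel in the product.\<close>

lemma uu_pp_nonneg: "i \<le> D \<Longrightarrow> 0 \<le> uu i * pp i"
proof (induction i)
  case (Suc i)
  have "uu (Suc i) * pp (Suc i)
      = ((1 + \<alpha> * q i) / (\<beta> - \<alpha> * q i)) * (\<rho> i / cc (Suc i)) * (uu i * pp i)" by simp
  moreover have "0 \<le> (1 + \<alpha> * q i) / (\<beta> - \<alpha> * q i)" "0 \<le> \<rho> i / cc (Suc i)"
    using one_alpha_pos[of i] beta_alpha_pos[of i] rho_pos[of i] cc_Suc_pos[of i] Suc.prems by auto
  moreover have "0 \<le> uu i * pp i" using Suc by simp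
  ultimately show ?case by (metis mult_nonneg_nonneg)
qed simp

definition \<kappa> :: real where "\<kappa> = (\<Sum>i\<le>D. uu i * pp i)"

lemma kappa_pos: "0 < \<kappa>"
proof -
  have "uu 0 * pp 0 \<le> \<kappa>" unfolding \<kappa>_def using uu_pp_nonneg by (intro member_le_sum) auto
  then show ?thesis by simp
qed

text \<open>Both outer terms are multiples of \<open>uu i\<close>, and \<open>aa_plus_r\<close>
  makes the coefficients add up. Hence \<open>uu\<close> of the distance to a fixed vertex is an
  eigenvector for \<open>-r\<close>.\<close>

lemma uu_three_term:
  assumes "i \<le> D" shows "cc i * uu (i - 1) + aa i * uu i + real (bi i) * uu (Suc i) = - r * uu i"
proof -
  have 1: "cc i * uu (i - 1) = - q i * (\<beta> - \<alpha> * q (i - 1)) * uu i"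
  proof (cases i)
    case (Suc j)
    then show ?thesis
      using cc_eq[OF assms] beta_alpha_pos[of j] one_alpha_pos[of j] assms by simp
  qed (simp add: cc_def)
  have 2: "real (bi i) * uu (Suc i) = - \<rho> i * uu i"
    using bi_eq[OF assms] beta_alpha_pos[OF assms] by (simp add: \<rho>_def)
  show ?thesis unfolding 1 2 using aa_plus_r[OF assms] by algebra
qed

text \<open>The second-order recurrence collapses to the first-order one defining \<open>pp\<close>,
  with equalities in place of the inequalities of \<open>eigenvalue_ge\<close>.\<close>

lemma shell_sum_eigen_min:
  assumes x: "x \<in> V" and eig: "\<And>y. y \<in> V \<Longrightarrow> (\<Sum>z\<in>nbrs y. f z) = - r * f y" and "i \<le> D"
  shows "shell_sum i f x = pp i * f x"
proof -
  let ?W = "\<lambda>i. shell_sum i f x"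
  have *: "cc (Suc i) * ?W (Suc i) = - \<rho> i * ?W i" if "i \<le> D" for i
    using that
  proof (induction i)
    case 0
    have "\<rho> 0 = aa 0 + r" using aa_plus_r[of 0] by simp
    then show ?case using shell_sum_eigen[OF x eig, of 0] by simp
  next
    case (Suc i)
    then have iD: "i < D" by simp
    have "cc (Suc i) * ?W (Suc i) = - \<rho> i * ?W i" "cc (Suc i) = q (Suc i) * (1 + \<alpha> * q i)"
      using Suc cc_eq[of "Suc i"] by auto
    then have "(1 + \<alpha> * q i) * (q (Suc i) * ?W (Suc i)) = (1 + \<alpha> * q i) * (- (r - q i) * ?W i)"
      unfolding \<rho>_def by algebra
    then have eq: "q (Suc i) * ?W (Suc i) = - (r - q i) * ?W i" using one_alpha_pos[of i] by simp
    have "cc (Suc (Suc i)) * ?W (Suc (Suc i)) = - (aa (Suc i) + r) * ?W (Suc i) - bi i * ?W i"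
      using shell_sum_eigen[OF x eig, of "Suc i"] by (simp add: algebra_simps)
    moreover have "bi i * ?W i = - (\<beta> - \<alpha> * q i) * (q (Suc i) * ?W (Suc i))"
      unfolding eq bi_eq[OF less_imp_le[OF iD]] by algebra
    moreover have "aa (Suc i) + r = q (Suc i) * (\<beta> - \<alpha> * q i) + \<rho> (Suc i)"
      using aa_plus_r[of "Suc i"] iD by simp
    ultimately show ?case by algebra
  qed
  show ?thesis using \<open>i \<le> D\<close>
  proof (induction i)
    case 0 then show ?case using shell_sum_0[OF x] by simp
  next
    case (Suc i)
    then show ?case using *[of i] cc_Suc_pos[of i] by (simp add: field_simps)
  qed
qed

text \<open>This is \<open>\<kappa>\<close> times the orthogonal projection onto the eigenspace of
  \<open>-r\<close>; leaving it unnormalised avoids divisions.\<close>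

definition proj :: "('a \<Rightarrow> real) \<Rightarrow> 'a \<Rightarrow> real" where
  "proj g z = (\<Sum>x\<in>V. uu (dst z x) * g x)"

text \<open>Each column of the kernel is an eigenvector for \<open>-r\<close>, so its shell sums are
  known; weighting them with \<open>uu\<close> produces \<open>\<kappa>\<close>.\<close>

lemma proj_kernel_square:
  assumes "x \<in> V" "y \<in> V"
  shows "(\<Sum>z\<in>V. uu (dst z x) * uu (dst z y)) = \<kappa> * uu (dst x y)"
proof -
  have "(\<Sum>z\<in>nbrs w. uu (dst y z)) = - r * uu (dst y w)" if "w \<in> V" for w
    using sum_nbrs_radial[OF assms(2) that refl, of uu] uu_three_term[OF dst_le_D[OF assms(2) that]] by simp
  then have "shell_sum i (\<lambda>z. uu (dst y z)) x = pp i * uu (dst y x)" if "i \<le> D" for i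
    using shell_sum_eigen_min[OF assms(1), of "\<lambda>z. uu (dst y z)"] that by simp
  then have "(\<Sum>i\<le>D. uu i * shell_sum i (\<lambda>z. uu (dst y z)) x) = (\<Sum>i\<le>D. uu i * pp i) * uu (dst y x)"
    unfolding sum_distrib_right by (intro sum.cong) (auto simp: mult.assoc)
  then show ?thesis
    using sum_radial_mult[OF assms(1), of uu "\<lambda>z. uu (dst y z)"] by (simp add: \<kappa>_def dst_commute)
qed

lemma sum_proj_square: "(\<Sum>z\<in>V. (proj g z)\<^sup>2) = \<kappa> * (\<Sum>x\<in>V. g x * proj g x)"
proof -
  have "(\<Sum>z\<in>V. (proj g z)\<^sup>2)
      = (\<Sum>z\<in>V. \<Sum>x\<in>V. \<Sum>y\<in>V. g x * g y * (uu (dst z x) * uu (dst z y)))"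
    by (simp add: proj_def power2_eq_square sum_product mult_ac)
  also have "\<dots> = (\<Sum>x\<in>V. \<Sum>z\<in>V. \<Sum>y\<in>V. g x * g y * (uu (dst z x) * uu (dst z y)))"
    by (rule sum.swap)
  also have "\<dots> = (\<Sum>x\<in>V. \<Sum>y\<in>V. \<Sum>z\<in>V. g x * g y * (uu (dst z x) * uu (dst z y)))"
    by (intro sum.cong refl sum.swap)
  also have "\<dots> = (\<Sum>x\<in>V. \<Sum>y\<in>V. g x * g y * (\<kappa> * uu (dst x y)))"
    by (intro sum.cong refl) (simp add: proj_kernel_square flip: sum_distrib_left)
  also have "\<dots> = \<kappa> * (\<Sum>x\<in>V. g x * proj g x)"
    by (simp add: proj_def sum_distrib_left mult_ac)
  finally show ?thesis .
qed

lemma proj_indicator: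
  assumes "C \<subseteq> V" shows "proj (\<lambda>x. if x \<in> C then 1 else 0) z = (\<Sum>x\<in>C. uu (dst z x))"
  unfolding proj_def using assms by (intro sum.mono_neutral_cong_right) auto

text \<open>Inside a clique only the kernel values \<open>uu 0 = 1\<close> and
  \<open>uu 1 = - 1 / \<beta>\<close> occur.\<close>

lemma sum_proj_clique:
  assumes C: "clique V E C"
  shows "(\<Sum>x\<in>V. (if x \<in> C then 1 else 0) * proj (\<lambda>x. if x \<in> C then 1 else 0) x)
    = card C * (1 + \<beta> - card C) / \<beta>"
proof -
  have CV: "C \<subseteq> V" and finC: "finite C" using C finite_subset[OF _ finV] by (auto simp: clique_def)
  have "(\<Sum>y\<in>C. uu (dst x y)) = (1 + \<beta> - card C) / \<beta>" if x: "x \<in> C" for x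
  proof -
    have "(\<Sum>y\<in>C. uu (dst x y)) = uu (dst x x) + (\<Sum>y\<in>C - {x}. uu (dst x y))"
      using x finC by (simp add: sum.remove)
    also have "(\<Sum>y\<in>C - {x}. uu (dst x y)) = (\<Sum>y\<in>C - {x}. - 1 / \<beta>)"
    proof (intro sum.cong refl)
      fix y assume "y \<in> C - {x}"
      then have "E x y" "x \<in> V" "y \<in> V" using C x CV by (auto simp: clique_def)
      then have "dst x y = 1" using dst_eq_1 by blast
      then show "uu (dst x y) = - 1 / \<beta>" by simp
    qed
    also have "\<dots> = - (real (card C) - 1) / \<beta>"
    proof -
      have "1 \<le> card C" using x finC by (simp add: Suc_le_eq card_gt_0_iff) auto
      then show ?thesis using x finC beta_pos by (simp add: of_nat_diff field_simps)
    qed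
    finally show ?thesis using beta_pos by (simp add: field_simps)
  qed
  moreover have "(\<Sum>x\<in>V. (if x \<in> C then 1 else 0) * proj (\<lambda>x. if x \<in> C then 1 else 0) x)
      = (\<Sum>x\<in>C. \<Sum>y\<in>C. uu (dst x y))"
    using CV by (intro sum.mono_neutral_cong_right) (auto simp: proj_indicator)
  ultimately show ?thesis by simp
qed

text \<open>The Delsarte bound: the form in \<open>sum_proj_clique\<close> is a squared norm up to
  the positive factor \<open>\<kappa>\<close>, hence nonnegative.\<close>

lemma clique_bound:
  assumes C: "clique V E C" shows "card C \<le> 1 + \<beta>"
proof (rule ccontr)
  assume "\<not> ?thesis"
  then have "real (card C) * (1 + \<beta> - card C) / \<beta> < 0"
    using beta_pos by (intro divide_neg_pos mult_pos_neg) auto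
  moreover have "0 \<le> \<kappa> * (real (card C) * (1 + \<beta> - card C) / \<beta>)"
    unfolding sum_proj_clique[OF C, symmetric] sum_proj_square[symmetric] by (simp add: sum_nonneg)
  ultimately show False using kappa_pos by (metis mult_pos_neg not_le)
qed

text \<open>Equality in the Delsarte bound makes the projected indicator of \<open>C\<close> vanish.
  At \<open>z\<close> this is one linear equation for the number of neighbours, since all points of
  \<open>C\<close> are at distance 1 or 2 from \<open>z\<close>.\<close>

lemma delsarte_clique_nbrs:
  assumes C: "clique V E C" and card: "card C = 1 + \<beta>" and z: "z \<in> V" "z \<notin> C" "\<exists>y\<in>C. E z y"
  shows "card {y \<in> C. E z y} = 1 + \<alpha>"
proof -
  let ?g = "\<lambda>x. if x \<in> C then 1 else 0"
  have CV: "C \<subseteq> V" and finC: "finite C" using C finite_subset[OF _ finV] by (auto simp: clique_def)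
  have "(\<Sum>w\<in>V. (proj ?g w)\<^sup>2) = 0"
    unfolding sum_proj_square sum_proj_clique[OF C] using card by simp
  then have "proj ?g z = 0" using z by (subst (asm) sum_nonneg_eq_0_iff) auto
  then have 0: "(\<Sum>y\<in>C. uu (dst z y)) = 0" using proj_indicator[OF CV] by simp
  define n where "n = card {y \<in> C. E z y}"
  obtain y0 where y0: "y0 \<in> C" "E z y0" using z by blast
  have d: "dst z y = (if E z y then 1 else 2)" if y: "y \<in> C" for y
  proof (cases "E z y")
    case True then show ?thesis using dst_eq_1 z CV y by auto
  next
    case False
    then have "E y0 y" using C y0 y by (auto simp: clique_def)
    then have "dst z y \<le> Suc (dst z y0)" using dst_step z by blast
    also have "dst z y0 = 1" using dst_eq_1 y0 z CV by auto
    finally have "dst z y \<le> 2" by simp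
    moreover have "dst z y \<noteq> 0" "dst z y \<noteq> 1" using dst_eq_0 dst_eq_1 z CV y False by blast+
    ultimately show ?thesis using False by simp
  qed
  have "(\<Sum>y\<in>C. uu (dst z y)) = (\<Sum>y\<in>{y \<in> C. E z y}. uu (dst z y)) + (\<Sum>y\<in>C - {y \<in> C. E z y}. uu (dst z y))"
    using finC by (subst add.commute) (intro sum.subset_diff, auto)
  also have "(\<Sum>y\<in>{y \<in> C. E z y}. uu (dst z y)) = (\<Sum>y\<in>{y \<in> C. E z y}. uu 1)"
    using d by (intro sum.cong) auto
  also have "(\<Sum>y\<in>C - {y \<in> C. E z y}. uu (dst z y)) = (\<Sum>y\<in>C - {y \<in> C. E z y}. uu 2)"
    using d by (intro sum.cong) auto
  also have "(\<Sum>y\<in>C - {y \<in> C. E z y}. uu 2) = (card C - real n) * uu 2"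
  proof -
    have "card (C - {y \<in> C. E z y}) = card C - n" "n \<le> card C"
      unfolding n_def using finC by (auto intro: card_Diff_subset card_mono)
    then show ?thesis by (simp add: of_nat_diff)
  qed
  finally have "n * uu 1 + (1 + \<beta> - n) * uu 2 = 0" using 0 card by (simp add: n_def)
  moreover have ba: "0 < \<beta> - \<alpha>" using beta_alpha_pos[of 1] D_ge by simp
  moreover have "\<beta> * uu 1 = - 1" "\<beta> * ((\<beta> - \<alpha>) * uu 2) = 1 + \<alpha>"
    using ba beta_pos by (simp_all add: numeral_2_eq_2)
  ultimately have "(1 + \<beta> - n) * (1 + \<alpha>) = n * (\<beta> - \<alpha>)" by algebra
  then have "(1 + \<beta>) * n = (1 + \<beta>) * (1 + \<alpha>)" by (simp add: algebra_simps)
  then show ?thesis using beta_pos by (simp add: n_def)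
qed

end

section \<open>Lines from claws\<close>

text \<open>The second Bonferroni inequality, doubled so that the number of pairs needs no division
  by 2.\<close>

lemma card_UN_bonferroni:
  fixes B :: "'i \<Rightarrow> 'b set" and m e :: int
  assumes "finite T" "\<And>y. y \<in> T \<Longrightarrow> finite (B y)" "\<And>y. y \<in> T \<Longrightarrow> int (card (B y)) = m"
    "\<And>y z. y \<in> T \<Longrightarrow> z \<in> T \<Longrightarrow> y \<noteq> z \<Longrightarrow> int (card (B y \<inter> B z)) \<le> e"
  shows "2 * int (card T) * m \<le> 2 * int (card (\<Union>y\<in>T. B y)) + int (card T) * (int (card T) - 1) * e"
  using assms
proof (induction T rule: finite_induct)
  case (insert y T)
  define U where "U = (\<Union>y\<in>T. B y)"
  have fU: "finite U" using insert by (auto simp: U_def)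
  have IH: "2 * int (card T) * m \<le> 2 * int (card U) + int (card T) * (int (card T) - 1) * e"
    using insert by (auto simp: U_def)
  have "card (B y \<inter> U) = card (\<Union>z\<in>T. B y \<inter> B z)" by (simp add: U_def)
  also have "\<dots> \<le> (\<Sum>z\<in>T. card (B y \<inter> B z))" using insert.hyps(1) by (rule card_UN_le)
  finally have "int (card (B y \<inter> U)) \<le> (\<Sum>z\<in>T. int (card (B y \<inter> B z)))"
    by (simp flip: of_nat_sum)
  also have "\<dots> \<le> (\<Sum>z\<in>T. e)" using insert by (intro sum_mono) auto
  finally have meet: "int (card (B y \<inter> U)) \<le> int (card T) * e" by simp
  have "card (B y) + card U = card (B y \<union> U) + card (B y \<inter> U)"
    using fU insert.prems(1) by (intro card_Un_Int) auto
  then have "m + int (card U) = int (card (B y \<union> U)) + int (card (B y \<inter> U))"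
    using insert.prems(2)[OF insertI1] by linarith
  moreover have "(\<Union>y\<in>insert y T. B y) = B y \<union> U" by (simp add: U_def)
  moreover have "card (insert y T) = card T + 1" using insert by simp
  ultimately show ?case using IH meet by (simp add: algebra_simps)
qed simp

text \<open>\<open>valency_small\<close> says that a claw with \<open>s + 1\<close> leaves needs
  more neighbours than the valency offers. \<open>a1_ge\<close> makes lines large enough to meet in
  at most one point and to supply new claw leaves.\<close>

locale metsch_drg = drg +
  fixes s :: nat
  assumes D_ge_2: "2 \<le> D" and s_ge_2: "2 \<le> s"
    and a1_ge: "(2 * int s - 1) * (int (ci 2) - 1) \<le> a1 bi ci"
    and valency_small: "2 * int (bi 0) + (int s + 1) * int s * (int (ci 2) - 1)
      < 2 * (int s + 1) * (a1 bi ci + 1)"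
begin

abbreviation \<mu> :: int where "\<mu> \<equiv> int (ci 2)"
abbreviation a\<^sub>1 :: int where "a\<^sub>1 \<equiv> a1 bi ci"

definition lines :: "'a set set" where
  "lines = {C. maximal_clique V E C \<and> int (card C) \<ge> a\<^sub>1 + 2 - (\<mu> - 1) * (int s - 1)}"

definition claw :: "'a \<Rightarrow> 'a set \<Rightarrow> bool" where
  "claw x S \<longleftrightarrow> S \<subseteq> nbrs x \<and> (\<forall>y\<in>S. \<forall>z\<in>S. \<not> E y z)"

lemma mu_pos: "1 \<le> \<mu>"
  using ci_pos[of 2] D_ge_2 by simp

lemma card_common_nbrs_adjacent:
  assumes "E x y" shows "int (card (nbrs x \<inter> nbrs y)) = a\<^sub>1"
proof -
  have xy: "x \<in> V" "y \<in> V" using assms edge_in by auto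
  have d: "dst x y = 1" using dst_eq_1 xy assms by blast
  have "{z \<in> nbrs y. dst x z = dst x y} = nbrs x \<inter> nbrs y"
    unfolding d using dst_eq_1[OF xy(1)] by (auto dest: edge_in)
  then have "real (card (nbrs x \<inter> nbrs y)) = aa 1" using card_nbrs_level[OF xy] d by simp
  also have "\<dots> = real_of_int a\<^sub>1" by (simp add: aa_def a1_def cc_def)
  finally show ?thesis by linarith
qed

lemma card_common_nbrs_nonadjacent:
  assumes "x \<noteq> y" "\<not> E x y" shows "int (card (nbrs x \<inter> nbrs y)) \<le> \<mu>"
proof (cases "nbrs x \<inter> nbrs y = {}")
  case False
  then obtain w where w: "E x w" "E y w" by auto
  then have xy: "x \<in> V" "y \<in> V" "E w y" using edge_in edge_sym by auto
  have "dst x w = 1" using dst_eq_1 w edge_in by blast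
  then have "dst x y \<le> 2" using dst_step[OF xy(1,3)] by simp
  moreover have "dst x y \<noteq> 0" "dst x y \<noteq> 1" using dst_eq_0 dst_eq_1 xy assms by blast+
  ultimately have d: "dst x y = 2" by linarith
  have "{z \<in> nbrs y. Suc (dst x z) = dst x y} = nbrs x \<inter> nbrs y"
    unfolding d using dst_eq_1[OF xy(1)] by (auto dest: edge_in)
  then show ?thesis using card_nbrs_inner[OF xy(1,2)] d by (simp add: cc_def)
qed (metis card.empty of_nat_0 of_nat_0_le_iff)

lemma card_common_nbrs_minus:
  assumes "y \<noteq> z" "\<not> E y z" "E x y" "E x z" shows "int (card (nbrs y \<inter> nbrs z - {x})) \<le> \<mu> - 1"
proof -
  have "x \<in> nbrs y \<inter> nbrs z" using assms edge_sym by auto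
  moreover have "finite (nbrs y \<inter> nbrs z)" by simp
  ultimately have "card (nbrs y \<inter> nbrs z) = Suc (card (nbrs y \<inter> nbrs z - {x}))"
    by (meson card.remove)
  then show ?thesis using card_common_nbrs_nonadjacent[OF assms(1,2)] by linarith
qed

lemma finite_claw: "claw x S \<Longrightarrow> finite S"
  unfolding claw_def using finite_subset finite_nbrs by blast

text \<open>Each of \<open>s + 1\<close> leaves takes up \<open>a\<^sub>1 + 1\<close> neighbours of
  \<open>x\<close>, and two leaves share at most \<open>\<mu> - 1\<close> of them; by Bonferroni the
  union would exceed the valency.\<close>

lemma claw_card: assumes S: "claw x S" shows "card S \<le> s"
proof (rule ccontr)
  assume "\<not> ?thesis"
  then obtain T where T: "T \<subseteq> S" "card T = s + 1" using obtain_subset_with_card_n[of "s + 1" S] by auto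
  have adj: "E x y" if "y \<in> T" for y using that T S by (auto simp: claw_def)
  have nadj: "\<not> E y z" if "y \<in> T" "z \<in> T" for y z using that T S by (auto simp: claw_def)
  define B where "B y = insert y (nbrs x \<inter> nbrs y)" for y
  have fT: "finite T" using T(2) card.infinite by fastforce
  have "finite (B y)" for y by (simp add: B_def)
  moreover have "int (card (B y)) = a\<^sub>1 + 1" if "y \<in> T" for y
    using card_common_nbrs_adjacent[OF adj[OF that]] by (simp add: B_def)
  moreover have "int (card (B y \<inter> B z)) \<le> \<mu> - 1" if "y \<in> T" "z \<in> T" "y \<noteq> z" for y z
  proof -
    \<comment> \<open>Independence keeps each leaf out of the set of the other; \<open>x\<close> is
      a common neighbour of both leaves but not of itself.\<close>
    have "B y \<inter> B z \<subseteq> nbrs y \<inter> nbrs z - {x}"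
      using nadj[OF that(1,2)] nadj[OF that(2,1)] that(3) by (auto simp: B_def)
    then have "card (B y \<inter> B z) \<le> card (nbrs y \<inter> nbrs z - {x})" by (intro card_mono) auto
    then show ?thesis
      using card_common_nbrs_minus[OF that(3) nadj[OF that(1,2)] adj[OF that(1)] adj[OF that(2)]] by linarith
  qed
  ultimately have "2 * int (card T) * (a\<^sub>1 + 1)
      \<le> 2 * int (card (\<Union>y\<in>T. B y)) + int (card T) * (int (card T) - 1) * (\<mu> - 1)"
    using fT by (intro card_UN_bonferroni) auto
  moreover have "card (\<Union>y\<in>T. B y) \<le> bi 0"
  proof (cases "T = {}")
    case False
    then obtain y where "y \<in> T" by blast
    then have "x \<in> V" using adj edge_in by blast
    then have "card (nbrs x) = bi 0" by (rule card_nbrs)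
    moreover have "(\<Union>y\<in>T. B y) \<subseteq> nbrs x" using adj by (auto simp: B_def)
    ultimately show ?thesis by (metis card_mono finite_nbrs)
  qed simp
  ultimately show False using valency_small unfolding T(2) by (simp add: algebra_simps)
qed

lemma clique_extends:
  assumes "clique V E C" obtains M where "C \<subseteq> M" "maximal_clique V E M"
proof -
  have "finite {M. clique V E M}" by (rule finite_subset[of _ "Pow V"]) (auto simp: clique_def)
  then obtain M where "clique V E M" "C \<subseteq> M" "\<And>M'. clique V E M' \<Longrightarrow> M \<subseteq> M' \<Longrightarrow> M' = M"
    using finite_has_maximal2[of "{M. clique V E M}" C] assms by blast
  then show ?thesis using that by (auto simp: maximal_clique_def)
qed

lemma line_clique: "l \<in> lines \<Longrightarrow> clique V E l"
  by (simp add: lines_def maximal_clique_def)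

lemma line_subset: "l \<in> lines \<Longrightarrow> l \<subseteq> V"
  using line_clique by (auto simp: clique_def)

lemma finite_line: "l \<in> lines \<Longrightarrow> finite l"
  using line_subset finite_subset finV by blast

lemma finite_lines: "finite lines"
  by (rule finite_subset[of _ "Pow V"]) (auto dest: line_subset)

lemma line_adj: "l \<in> lines \<Longrightarrow> x \<in> l \<Longrightarrow> y \<in> l \<Longrightarrow> x \<noteq> y \<Longrightarrow> E x y"
  using line_clique by (auto simp: clique_def)

lemma line_maximal: "l \<in> lines \<Longrightarrow> l' \<in> lines \<Longrightarrow> l \<subseteq> l' \<Longrightarrow> l = l'"
  by (auto simp: lines_def maximal_clique_def)

lemma card_line: "l \<in> lines \<Longrightarrow> a\<^sub>1 + 2 - (\<mu> - 1) * (int s - 1) \<le> int (card l)"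
  by (simp add: lines_def)

lemma nonadjacent_on_line:
  assumes "l \<in> lines" "x \<in> V" "x \<notin> l" obtains y where "y \<in> l" "y \<noteq> x" "\<not> E x y"
proof -
  have "\<exists>y\<in>l. \<not> E x y"
  proof (rule ccontr)
    assume "\<not> ?thesis"
    then have "\<forall>y\<in>l. E x y \<and> E y x" using edge_sym by blast
    then have "clique V E (insert x l)" using line_clique[OF assms(1)] assms(2) by (auto simp: clique_def)
    then show False using assms by (auto simp: lines_def maximal_clique_def)
  qed
  then show ?thesis using that assms(3) by blast
qed

text \<open>By maximality some \<open>y\<close> on \<open>l\<close> is not adjacent to
  \<open>x\<close>, and every neighbour of \<open>x\<close> on \<open>l\<close> is a common
  neighbour of \<open>x\<close> and \<open>y\<close>.\<close>

lemma card_line_nbrs: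
  assumes "l \<in> lines" "x \<in> V" "x \<notin> l" shows "int (card {y \<in> l. E x y}) \<le> \<mu>"
proof -
  obtain y where y: "y \<in> l" "y \<noteq> x" "\<not> E x y" using nonadjacent_on_line[OF assms] by blast
  have "{z \<in> l. E x z} \<subseteq> nbrs x \<inter> nbrs y" using line_adj[OF assms(1) y(1)] y(3) by auto
  then have "card {z \<in> l. E x z} \<le> card (nbrs x \<inter> nbrs y)" by (intro card_mono) auto
  then show ?thesis using card_common_nbrs_nonadjacent[of x y] y by fastforce
qed

text \<open>Distinct lines overlap in at most \<mu> points, so their union is large; with two common
  points it lies within these and their common neighbours, at most \<open>a\<^sub>1 + 2\<close>
  points. This contradicts \<open>a1_ge\<close>.\<close>

lemma lines_meet:
  assumes "l \<in> lines" "l' \<in> lines" "x \<in> l" "x \<in> l'" "y \<in> l" "y \<in> l'" "x \<noteq> y" shows "l = l'"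
proof (rule ccontr)
  assume ne: "l \<noteq> l'"
  then obtain z where z: "z \<in> l" "z \<notin> l'" using line_maximal assms by blast
  have fin: "finite l" "finite l'" using finite_line assms by auto
  have "l \<inter> l' \<subseteq> {y \<in> l'. E z y}" using line_adj[OF assms(1) z(1)] z(2) by auto
  then have "card (l \<inter> l') \<le> card {y \<in> l'. E z y}" using fin by (intro card_mono) auto
  then have 1: "int (card (l \<inter> l')) \<le> \<mu>"
    using card_line_nbrs[OF assms(2) _ z(2)] line_subset[OF assms(1)] z(1) by fastforce
  have "l \<union> l' \<subseteq> insert x (insert y (nbrs x \<inter> nbrs y))"
    using line_adj assms by auto
  then have "card (l \<union> l') \<le> card (insert x (insert y (nbrs x \<inter> nbrs y)))" by (intro card_mono) auto
  also have "\<dots> \<le> card (nbrs x \<inter> nbrs y) + 2" by (simp add: card_insert_if)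
  finally have 2: "int (card (l \<union> l')) \<le> a\<^sub>1 + 2"
    using card_common_nbrs_adjacent[OF line_adj[OF assms(1,3,5,7)]] by linarith
  have "int (card l) + int (card l') = int (card (l \<union> l')) + int (card (l \<inter> l'))"
    using card_Un_Int[OF fin] by linarith
  moreover define X where "X = (\<mu> - 1) * (int s - 1)"
  moreover have "(2 * int s - 1) * (\<mu> - 1) = 2 * X + \<mu> - 1" by (simp add: X_def algebra_simps)
  ultimately show False using 1 2 card_line[OF assms(1)] card_line[OF assms(2)] a1_ge by linarith
qed

text \<open>A greedy choice of one leaf per line. Each earlier leaf blocks at most
  \<open>\<mu> - 1\<close> points of a line besides \<open>x\<close>, and at most \<open>s\<close>
  leaves precede a choice, while a line has more than \<open>s * (\<mu> - 1)\<close> points besides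
  \<open>x\<close>.\<close>

lemma extend_claw_by_lines:
  assumes "finite M" "M \<subseteq> {l \<in> lines. x \<in> l}" "claw x Z" "\<And>l. l \<in> M \<Longrightarrow> Z \<inter> l = {}"
    "card Z + card M \<le> s + 1"
  shows "\<exists>Z'. claw x Z' \<and> card Z' = card Z + card M"
  using assms
proof (induction M arbitrary: Z rule: finite_induct)
  case (insert l M)
  have l: "l \<in> lines" "x \<in> l" using insert.prems(1) by auto
  have fl: "finite l" and fZ: "finite Z" using finite_line l finite_claw insert.prems by auto
  have disj: "Z \<inter> l = {}" using insert.prems(3) by auto
  define bad where "bad = (\<Union>y\<in>Z. {w \<in> l. E y w} - {x})"
  have each: "int (card ({w \<in> l. E y w} - {x})) \<le> \<mu> - 1" if y: "y \<in> Z" for y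
  proof -
    have "y \<in> V" "E y x" using y insert.prems(2) edge_in edge_sym by (auto simp: claw_def)
    moreover have "y \<notin> l" using y disj by auto
    ultimately have "x \<in> {w \<in> l. E y w}" "int (card {w \<in> l. E y w}) \<le> \<mu>"
      using card_line_nbrs l by auto
    moreover have "finite {w \<in> l. E y w}" using fl by simp
    ultimately show ?thesis using card.remove[of "{w \<in> l. E y w}" x] by linarith
  qed
  have "card bad \<le> (\<Sum>y\<in>Z. card ({w \<in> l. E y w} - {x}))" unfolding bad_def using fZ by (rule card_UN_le)
  then have "int (card bad) \<le> (\<Sum>y\<in>Z. int (card ({w \<in> l. E y w} - {x})))" by (simp flip: of_nat_sum)
  also have "\<dots> \<le> (\<Sum>y\<in>Z. \<mu> - 1)" by (intro sum_mono each)
  also have "\<dots> \<le> int s * (\<mu> - 1)"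
    using insert.prems(4) insert.hyps mu_pos by (auto intro: mult_right_mono)
  also have "\<dots> < int (card l) - 1" using card_line[OF l(1)] a1_ge by (simp add: algebra_simps)
  also have "\<dots> = int (card (l - {x}))" using card.remove[OF fl l(2)] by linarith
  finally have "\<not> l - {x} \<subseteq> bad" using card_mono[of bad "l - {x}"] fl fZ by (auto simp: bad_def)
  then obtain z where z: "z \<in> l" "z \<noteq> x" "\<forall>y\<in>Z. \<not> E y z" by (auto simp: bad_def)
  have xz: "E x z" using line_adj l z by auto
  have zZ: "z \<notin> Z" using z disj by auto
  have "claw x (insert z Z)"
    using insert.prems(2) xz z(3) edge_sym[of z] by (auto simp: claw_def)
  \<comment> \<open>Lines through \<open>x\<close> meet only in \<open>x\<close>, so the new leaf
    stays off the remaining ones, as the induction requires.\<close>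
  moreover have "insert z Z \<inter> l' = {}" if "l' \<in> M" for l'
  proof -
    have "l' \<in> lines" "x \<in> l'" "l \<noteq> l'" using that insert.prems(1) insert.hyps(2) by auto
    then have "z \<notin> l'" using lines_meet[OF l(1) _ l(2) _ z(1)] z(2) by blast
    then show ?thesis using insert.prems(3)[of l'] that by auto
  qed
  ultimately have "\<exists>Z'. claw x Z' \<and> card Z' = card (insert z Z) + card M"
    using insert.prems(1,4) insert.hyps zZ fZ by (intro insert.IH) auto
  then show ?case using insert.hyps zZ fZ by simp
qed auto

lemma card_lines_through: "card {l \<in> lines. x \<in> l} \<le> s"
proof (rule ccontr)
  assume "\<not> ?thesis"
  then obtain M where M: "M \<subseteq> {l \<in> lines. x \<in> l}" "card M = s + 1" "finite M"
    using obtain_subset_with_card_n[of "s + 1" "{l \<in> lines. x \<in> l}"] by auto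
  have "\<exists>Z'. claw x Z' \<and> card Z' = card ({} :: 'a set) + card M"
    by (rule extend_claw_by_lines[OF M(3,1)]) (simp_all add: claw_def M(2))
  then show False using claw_card M(2) by fastforce
qed

text \<open>Two nonadjacent vertices of \<open>Q\<close> could replace \<open>y\<close> and enlarge
  the claw, so \<open>Q\<close> with \<open>x\<close> and \<open>y\<close> is a clique. Every other
  leaf excludes at most \<open>\<mu> - 1\<close> of the \<open>a\<^sub>1\<close> common neighbours,
  which yields exactly the size threshold of \<open>lines\<close>.\<close>

lemma line_through_claw_point:
  assumes S: "claw x S" and max: "\<And>T. claw x T \<Longrightarrow> card T \<le> card S" and y: "y \<in> S"
  shows "\<exists>l\<in>lines. x \<in> l \<and> y \<in> l"
proof -
  define Q where "Q = {z \<in> nbrs x \<inter> nbrs y. \<forall>w\<in>S - {y}. \<not> E z w}"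
  have fS: "finite S" using finite_claw S by blast
  have adj: "E x w" if "w \<in> S" for w using S that by (auto simp: claw_def)
  have nadj: "\<not> E v w" if "v \<in> S" "w \<in> S" for v w using S that by (auto simp: claw_def)
  have Qadj: "E z z'" if zz: "z \<in> Q" "z' \<in> Q" "z \<noteq> z'" for z z'
  proof (rule ccontr)
    assume n: "\<not> E z z'"
    have n': "\<not> E z' z" using n edge_sym by blast
    have a: "\<forall>w\<in>S - {y}. \<not> E z w \<and> \<not> E w z" "\<forall>w\<in>S - {y}. \<not> E z' w \<and> \<not> E w z'"
      using zz edge_sym[of _ z] edge_sym[of _ z'] by (auto simp: Q_def)
    have "claw x (insert z (insert z' (S - {y})))"
      using a n n' zz S by (auto simp: claw_def Q_def)
    moreover have notin: "z \<notin> S" "z' \<notin> S"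
      using zz nadj[OF y] by (auto simp: Q_def)
    moreover have "card (insert z (insert z' (S - {y}))) = card S + 1"
      using notin zz(3) fS y card.remove[OF fS y] by simp
    ultimately show False using max by fastforce
  qed
  have xy: "x \<in> V" "y \<in> V" "E x y" "E y x" using adj[OF y] edge_in edge_sym by auto
  define C where "C = insert x (insert y Q)"
  have "clique V E C"
    unfolding clique_def C_def using Qadj xy by (auto simp: Q_def dest: edge_in edge_sym)
  then obtain l where l: "C \<subseteq> l" "maximal_clique V E l" by (rule clique_extends)
  have fQ: "finite Q" by (simp add: Q_def)
  have "x \<notin> insert y Q" "y \<notin> Q" using xy(3) by (auto simp: Q_def)
  then have cC: "card C = card Q + 2" using fQ by (simp add: C_def)
  define R where "R = (\<Union>w\<in>S - {y}. nbrs y \<inter> nbrs w - {x})"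
  have "card R \<le> (\<Sum>w\<in>S - {y}. card (nbrs y \<inter> nbrs w - {x}))"
    unfolding R_def using fS by (intro card_UN_le) auto
  then have "int (card R) \<le> (\<Sum>w\<in>S - {y}. int (card (nbrs y \<inter> nbrs w - {x})))" by (simp flip: of_nat_sum)
  also have "\<dots> \<le> (\<Sum>w\<in>S - {y}. \<mu> - 1)"
    using nadj adj y by (intro sum_mono card_common_nbrs_minus) auto
  also have "\<dots> = int (card (S - {y})) * (\<mu> - 1)" by simp
  also have "\<dots> \<le> (int s - 1) * (\<mu> - 1)"
    using claw_card[OF S] card.remove[OF fS y] mu_pos by (intro mult_right_mono) auto
  finally have R: "int (card R) \<le> (int s - 1) * (\<mu> - 1)" .
  have "nbrs x \<inter> nbrs y \<subseteq> Q \<union> R" by (auto simp: Q_def R_def intro: edge_sym)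
  then have "card (nbrs x \<inter> nbrs y) \<le> card (Q \<union> R)" using fQ fS by (intro card_mono) (auto simp: R_def)
  also have "\<dots> \<le> card Q + card R" by (rule card_Un_le)
  finally have "a\<^sub>1 + 2 - (\<mu> - 1) * (int s - 1) \<le> int (card C)"
    using R card_common_nbrs_adjacent[OF xy(3)] cC by (simp add: mult.commute)
  moreover have "card C \<le> card l"
    using l by (intro card_mono) (auto simp: maximal_clique_def clique_def intro: finite_subset[OF _ finV])
  ultimately have "l \<in> lines" using l by (simp add: lines_def)
  then show ?thesis using l(1) by (auto simp: C_def)
qed

text \<open>The leaves of a maximum claw at \<open>x\<close> lie on distinct lines through
  \<open>x\<close>. If no line covers the edge to \<open>y\<close>, the single leaf \<open>y\<close>
  extends along all these lines to a claw with one leaf too many.\<close>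

lemma edge_on_line: assumes e: "E x y" shows "\<exists>l\<in>lines. x \<in> l \<and> y \<in> l"
proof (rule ccontr)
  assume no: "\<not> ?thesis"
  have "claw x {}" by (simp add: claw_def)
  then obtain S where S: "claw x S" "\<And>T. claw x T \<Longrightarrow> card T \<le> card S"
    using ex_has_greatest_nat[of "claw x" "{}" card "Suc s"] claw_card by (auto simp: less_Suc_eq_le)
  then have "\<forall>z\<in>S. \<exists>l\<in>lines. x \<in> l \<and> z \<in> l" using line_through_claw_point by blast
  then obtain h where h: "\<And>z. z \<in> S \<Longrightarrow> h z \<in> lines \<and> x \<in> h z \<and> z \<in> h z" by metis
  have fS: "finite S" using S finite_claw by blast
  have "inj_on h S"
  proof (rule inj_onI, rule ccontr)
    fix z w assume zw: "z \<in> S" "w \<in> S" "h z = h w" "z \<noteq> w"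
    then have "E z w" using line_adj[of "h z" z w] h[of z] h[of w] by simp
    then show False using S(1) zw by (auto simp: claw_def)
  qed
  then have ch: "card (h ` S) = card S" by (rule card_image)
  have "\<exists>Z'. claw x Z' \<and> card Z' = card {y} + card (h ` S)"
    using e no h fS ch claw_card[OF S(1)]
    by (intro extend_claw_by_lines) (auto simp: claw_def)
  then show False using S(2) ch by fastforce
qed

lemma SPLS: "SPLS V E bi ci (ci 2) s"
proof -
  have "card {l \<in> lines. x \<in> l \<and> y \<in> l} \<le> 1" if "x \<noteq> y" for x y
  proof (rule ccontr)
    assume "\<not> ?thesis"
    then obtain l l' where "l \<in> lines" "l' \<in> lines" "l \<noteq> l'" "x \<in> l" "y \<in> l" "x \<in> l'" "y \<in> l'"
      by (auto simp: card_le_Suc0_iff_eq finite_lines)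
    then show False using lines_meet that by blast
  qed
  moreover have "E x y \<longleftrightarrow> (\<exists>l\<in>lines. x \<in> l \<and> y \<in> l)" if "x \<noteq> y" for x y
    using edge_on_line[of x y] line_adj[of _ x y] that by blast
  moreover have "card {y \<in> l. E x y} \<le> ci 2" if "l \<in> lines" "x \<in> V" "x \<notin> l" for x l
    using card_line_nbrs[OF that] by simp
  ultimately show ?thesis
    unfolding SPLS_def Let_def lines_def[symmetric]
    using mu_pos s_ge_2 a1_ge card_lines_through by auto
qed

end

section \<open>Counting along lines\<close>

context classical_drg
begin

lemma real_a1: "real_of_int (a1 bi ci) = \<beta> + \<alpha> * (r - 1) - 1"
  using bi_eq[of 0] bi_eq[of 1] cc_eq[of 1] D_ge by (simp add: a1_def cc_def algebra_simps)

text \<open>With \<open>T = \<beta> + \<alpha> * r\<close> the hypothesis on \<beta> reads exactly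
  \<open>8 / 3 * e * r \<le> T\<close>, which explains its coefficient 5. \<open>S\<close> stands
  for the floor and is constrained only by what rounding guarantees.\<close>

lemma spls_arithmetic:
  fixes S :: real
  defines "e \<equiv> real (ci 2) - 1"
  assumes S: "4 * r / 3 - 1 < S" "S \<le> 4 * r / 3"
  shows "(2 * S - 1) * e \<le> real_of_int (a1 bi ci)"
    and "2 * real (bi 0) + (S + 1) * S * e < 2 * (S + 1) * (real_of_int (a1 bi ci) + 1)"
    and "1 \<le> e"
proof -
  have e: "e = b + \<alpha> + \<alpha> * b" using ci_2 by (simp add: e_def algebra_simps)
  have b2: "real_of_int b \<ge> 2" using b_ge by simp
  have "0 \<le> \<alpha> * b" using alpha_nonneg b2 by simp
  then have e1: "1 + \<alpha> \<le> e" unfolding e using b2 by linarith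
  then show "1 \<le> e" using alpha_nonneg by simp
  have e0: "0 < e" using e1 alpha_nonneg by simp
  define T where "T = \<beta> + \<alpha> * r"
  have T: "8 / 3 * e * r \<le> T" using beta_large by (simp add: e T_def algebra_simps)
  have A: "real_of_int (a1 bi ci) = T - \<alpha> - 1" unfolding real_a1 T_def by (simp add: algebra_simps)
  have "2 * S * e \<le> 2 * (4 * r / 3) * e" using S e0 by (intro mult_right_mono) auto
  then show "(2 * S - 1) * e \<le> real_of_int (a1 bi ci)"
    using T e1 unfolding A by (simp add: algebra_simps)
  \<comment> \<open>The slack left by rounding. The constants 4/3 and 8/3 make the terms quadratic
    in \<open>r\<close> cancel below, and the remainder is positive.\<close>
  define \<epsilon> where "\<epsilon> = S + 1 - 4 * r / 3"
  have eps: "0 < \<epsilon>" "\<epsilon> \<le> 1" using S by (auto simp: \<epsilon>_def)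
  have n: "S = 4 * r / 3 + \<epsilon> - 1" by (simp add: \<epsilon>_def)
  have "\<epsilon> * \<epsilon> \<le> \<epsilon> * 1" using eps by (intro mult_left_mono) auto
  moreover have "0 < \<epsilon> * r" using eps r_ge_7 by simp
  moreover have "2 * (S + 1 - r) * (8 / 3 * r) - (S + 1) * S = 8 / 3 * (\<epsilon> * r) + 4 / 3 * r + \<epsilon> - \<epsilon> * \<epsilon>"
    unfolding n by (simp add: field_simps)
  ultimately have "(S + 1) * S < 2 * (S + 1 - r) * (8 / 3 * r)" using r_ge_7 by linarith
  then have "(S + 1) * S * e < 2 * (S + 1 - r) * (8 / 3 * r) * e" using e0 by (rule mult_strict_right_mono)
  also have "\<dots> = 2 * (S + 1 - r) * (8 / 3 * e * r)" by (simp add: mult_ac)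
  also have "\<dots> \<le> 2 * (S + 1 - r) * T" using T eps r_ge_7 by (intro mult_left_mono) (auto simp: n)
  finally have 1: "(S + 1) * S * e < 2 * (S + 1 - r) * T" .
  \<comment> \<open>The valency is \<open>r * (T - \<alpha> * r)\<close> and
    \<open>a\<^sub>1 + 1\<close> is \<open>T - \<alpha>\<close>, so the corrections to
    \<open>T\<close> amount to \<open>\<alpha> * (r * r)\<close> against
    \<open>\<alpha> * (S + 1)\<close>.\<close>
  have "7 * r \<le> r * r" using r_ge_7 by (intro mult_right_mono) auto
  then have "S + 1 \<le> r * r" using S r_ge_7 by linarith
  then have 2: "\<alpha> * (S + 1) \<le> \<alpha> * (r * r)" using alpha_nonneg by (rule mult_left_mono)
  have "2 * (S + 1) * (real_of_int (a1 bi ci) + 1) - 2 * real (bi 0)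
      = 2 * (S + 1 - r) * T + 2 * (\<alpha> * (r * r)) - 2 * (\<alpha> * (S + 1))"
    unfolding A using bi_eq[of 0] by (simp add: T_def algebra_simps)
  then show "2 * real (bi 0) + (S + 1) * S * e < 2 * (S + 1) * (real_of_int (a1 bi ci) + 1)"
    using 1 2 by linarith
qed

end

text \<open>Transfers the real estimates to the integer inequalities of the claw argument, with
  \<open>S\<close> the actual floor.\<close>

sublocale classical_drg \<subseteq> metsch_drg V E D bi ci "nat \<lfloor>4 * qnum b D / 3\<rfloor>"
proof unfold_locales
  define s where "s = nat \<lfloor>4 * r / 3\<rfloor>"
  have s: "real s = of_int \<lfloor>4 * r / 3\<rfloor>" using r_ge_7 by (simp add: s_def)
  have S: "4 * r / 3 - 1 < real s" "real s \<le> 4 * r / 3" unfolding s by linarith+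
  show "2 \<le> D" using D_ge by simp
  show "2 \<le> nat \<lfloor>4 * qnum b D / 3\<rfloor>" using S r_ge_7 unfolding s_def[symmetric] by linarith
  have "real_of_int ((2 * int s - 1) * (int (ci 2) - 1)) \<le> real_of_int (a1 bi ci)"
    using spls_arithmetic(1)[OF S] by simp
  then show "(2 * int (nat \<lfloor>4 * qnum b D / 3\<rfloor>) - 1) * (int (ci 2) - 1) \<le> a1 bi ci"
    unfolding s_def[symmetric] of_int_le_iff .
  have "real_of_int (2 * int (bi 0) + (int s + 1) * int s * (int (ci 2) - 1))
      < real_of_int (2 * (int s + 1) * (a1 bi ci + 1))"
    using spls_arithmetic(2)[OF S] by simp
  then show "2 * int (bi 0) + (int (nat \<lfloor>4 * qnum b D / 3\<rfloor>) + 1) * int (nat \<lfloor>4 * qnum b D / 3\<rfloor>) * (int (ci 2) - 1)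
      < 2 * (int (nat \<lfloor>4 * qnum b D / 3\<rfloor>) + 1) * (a1 bi ci + 1)"
    unfolding s_def[symmetric] of_int_less_iff .
qed

section \<open>Incidences of points and lines\<close>

context metsch_drg
begin

lemma sum_nbrs_lines:
  "(\<Sum>z\<in>nbrs x. f z) = (\<Sum>l\<in>{l \<in> lines. x \<in> l}. \<Sum>z\<in>l - {x}. f z)"
proof -
  have "nbrs x = (\<Union>l\<in>{l \<in> lines. x \<in> l}. l - {x})"
    using edge_on_line[of x] line_adj[of _ x] by fastforce
  then have "(\<Sum>z\<in>nbrs x. f z) = sum f (\<Union>l\<in>{l \<in> lines. x \<in> l}. l - {x})" by simp
  also have "\<dots> = (\<Sum>l\<in>{l \<in> lines. x \<in> l}. \<Sum>z\<in>l - {x}. f z)"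
  proof (rule sum.UNION_disjoint)
    show "\<forall>l\<in>{l \<in> lines. x \<in> l}. \<forall>l'\<in>{l \<in> lines. x \<in> l}. l \<noteq> l' \<longrightarrow> (l - {x}) \<inter> (l' - {x}) = {}"
      using lines_meet[of _ _ x] by blast
  qed (auto simp: finite_lines finite_line)
  finally show ?thesis .
qed

text \<open>Double counting of incidences: a line has at least \<open>s + 1\<close> points because
  \<open>\<mu> \<ge> 2\<close>, and a point lies on at most \<open>s\<close> lines.\<close>

lemma card_lines_less:
  assumes mu: "2 \<le> \<mu>" shows "card lines < card V"
proof (rule ccontr)
  assume "\<not> ?thesis"
  then have le: "card V \<le> card lines" by simp
  have "int s * 1 \<le> int s * (\<mu> - 1)" using mu by (intro mult_left_mono) auto
  moreover have "(2 * int s - 1) * (\<mu> - 1) = int s * (\<mu> - 1) + (\<mu> - 1) * (int s - 1)" by (simp add: algebra_simps)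
  ultimately have "s + 1 \<le> card l" if "l \<in> lines" for l
    using card_line[OF that] a1_ge by linarith
  then have "(\<Sum>l\<in>lines. s + 1) \<le> (\<Sum>l\<in>lines. card l)" by (intro sum_mono)
  also have "\<dots> = (\<Sum>l\<in>lines. \<Sum>x\<in>V. if x \<in> l then 1 else 0)"
  proof (intro sum.cong refl)
    fix l assume "l \<in> lines"
    then have "V \<inter> l = l" using line_subset by blast
    then show "card l = (\<Sum>x\<in>V. if x \<in> l then 1 else 0)" by (simp add: sum.If_cases)
  qed
  also have "\<dots> = (\<Sum>x\<in>V. \<Sum>l\<in>lines. if x \<in> l then 1 else 0)" by (rule sum.swap)
  also have "\<dots> = (\<Sum>x\<in>V. card {l \<in> lines. x \<in> l})"
    by (intro sum.cong refl) (simp add: sum.If_cases finite_lines Collect_conj_eq)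
  also have "\<dots> \<le> (\<Sum>x\<in>V. s)" by (intro sum_mono card_lines_through)
  finally have "card lines * (s + 1) \<le> card V * s" by simp
  moreover have "card V * (s + 1) \<le> card lines * (s + 1)" using le by (rule mult_right_mono) simp
  moreover have "0 < card V" using V_ne by (simp add: card_gt_0_iff)
  ultimately show False by (simp add: algebra_simps)
qed

end

section \<open>Lines attaining the clique bound\<close>

context classical_drg
begin

definition line_degree :: "'a \<Rightarrow> nat" where "line_degree x = card {l \<in> lines. x \<in> l}"

text \<open>Counts the \<open>r * \<beta>\<close> neighbours of \<open>x\<close> along lines. Each
  summand is the defect of a line from the Delsarte bound, nonnegative by
  \<open>clique_bound\<close>.\<close>

lemma sum_defect_lines:
  assumes "x \<in> V"
  shows "(\<Sum>l\<in>{l \<in> lines. x \<in> l}. 1 + \<beta> - card l) = (line_degree x - r) * \<beta>"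
proof -
  have "real (bi 0) = (\<Sum>z\<in>nbrs x. 1)" using card_nbrs[OF assms] by simp
  also have "\<dots> = (\<Sum>l\<in>{l \<in> lines. x \<in> l}. real (card l) - 1)"
    unfolding sum_nbrs_lines
  proof (intro sum.cong refl)
    fix l assume "l \<in> {l \<in> lines. x \<in> l}"
    then show "(\<Sum>z\<in>l - {x}. 1) = real (card l) - 1" using card.remove[of l x] finite_line by simp
  qed
  also have "\<dots> = (\<Sum>l\<in>{l \<in> lines. x \<in> l}. \<beta> - (1 + \<beta> - card l))" by simp
  also have "\<dots> = line_degree x * \<beta> - (\<Sum>l\<in>{l \<in> lines. x \<in> l}. 1 + \<beta> - card l)"
    by (simp only: sum_subtractf sum_constant line_degree_def)
  finally show ?thesis using bi_eq[of 0] by (simp add: algebra_simps)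
qed

lemma line_degree_ge: assumes "x \<in> V" shows "r \<le> line_degree x"
proof -
  have "0 \<le> (\<Sum>l\<in>{l \<in> lines. x \<in> l}. 1 + \<beta> - card l)"
    using clique_bound line_clique by (intro sum_nonneg) auto
  then show ?thesis unfolding sum_defect_lines[OF assms] using beta_pos by (simp add: zero_le_mult_iff)
qed

lemma card_line_eq:
  assumes "x \<in> V" "line_degree x = r" "l \<in> lines" "x \<in> l" shows "card l = 1 + \<beta>"
proof -
  have "(\<Sum>l\<in>{l \<in> lines. x \<in> l}. 1 + \<beta> - card l) = 0" using sum_defect_lines[OF assms(1)] assms(2) by simp
  then have "\<forall>l\<in>{l \<in> lines. x \<in> l}. 1 + \<beta> - card l = 0"
    using clique_bound line_clique finite_lines by (subst (asm) sum_nonneg_eq_0_iff) auto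
  then show ?thesis using assms by force
qed

lemma mu_ge_2: "2 \<le> \<mu>"
proof -
  have "4 * r / 3 - 1 < real_of_int \<lfloor>4 * r / 3\<rfloor>" "real_of_int \<lfloor>4 * r / 3\<rfloor> \<le> 4 * r / 3" by linarith+
  from spls_arithmetic(3)[OF this] show ?thesis by simp
qed

text \<open>As there are fewer lines than points, some nonzero \<open>v\<close> sums to zero on every line;
  positive semidefiniteness of \<open>A + r I\<close> forces exactly \<open>r\<close> lines through each point of its support.\<close>

lemma exists_line_free_vector:
  obtains v where "\<exists>x\<in>V. v x \<noteq> 0" "\<And>x. x \<in> V \<Longrightarrow> v x \<noteq> 0 \<Longrightarrow> line_degree x = r"
    "\<And>x. x \<in> V \<Longrightarrow> (\<Sum>z\<in>nbrs x. v z) = - r * v x"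
proof -
  obtain v where v: "\<exists>x\<in>V. v x \<noteq> 0"
    "\<forall>l\<in>lines. (\<Sum>x\<in>V. (if x \<in> l then 1 else 0) * v x) = (0::real)"
    using exists_nonzero_kernel_vector[OF finite_lines finV card_lines_less[OF mu_ge_2],
        of "\<lambda>l x. if x \<in> l then 1 else 0"] by blast
  have line0: "(\<Sum>x\<in>l. v x) = 0" if l: "l \<in> lines" for l
  proof -
    have "(\<Sum>x\<in>l. v x) = (\<Sum>x\<in>V. (if x \<in> l then 1 else 0) * v x)"
      using line_subset[OF l] by (intro sum.mono_neutral_cong_left) auto
    then show ?thesis using v(2) l by simp
  qed
  \<comment> \<open>As \<open>v\<close> sums to 0 on each line through \<open>x\<close>, the other
    points of that line contribute \<open>- v x\<close>.\<close>
  have adj: "(\<Sum>z\<in>nbrs x. v z) = - real (line_degree x) * v x" for x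
  proof -
    have "(\<Sum>z\<in>nbrs x. v z) = (\<Sum>l\<in>{l \<in> lines. x \<in> l}. - v x)"
      unfolding sum_nbrs_lines
    proof (intro sum.cong refl)
      fix l assume "l \<in> {l \<in> lines. x \<in> l}"
      then show "(\<Sum>z\<in>l - {x}. v z) = - v x"
        using line0[of l] sum.remove[of l x v] finite_line by simp
    qed
    then show ?thesis by (simp add: line_degree_def)
  qed
  \<comment> \<open>This sum is squeezed to 0: \<open>adjacency_form_ge\<close> makes it
    nonpositive, while \<open>line_degree_ge\<close> makes every summand nonnegative.\<close>
  have "(\<Sum>x\<in>V. (line_degree x - r) * (v x)\<^sup>2)
      = - r * (\<Sum>x\<in>V. (v x)\<^sup>2) - (\<Sum>x\<in>V. v x * (\<Sum>z\<in>nbrs x. v z))"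
    unfolding adj sum_distrib_left sum_subtractf[symmetric]
    by (intro sum.cong refl) (simp add: power2_eq_square algebra_simps)
  then have "(\<Sum>x\<in>V. (line_degree x - r) * (v x)\<^sup>2) \<le> 0" using adjacency_form_ge[of v] by linarith
  moreover have nn: "0 \<le> (line_degree x - r) * (v x)\<^sup>2" if "x \<in> V" for x
    using line_degree_ge[OF that] by simp
  ultimately have "(\<Sum>x\<in>V. (line_degree x - r) * (v x)\<^sup>2) = 0"
    by (intro antisym sum_nonneg) auto
  then have "\<forall>x\<in>V. (line_degree x - r) * (v x)\<^sup>2 = 0"
    by (subst (asm) sum_nonneg_eq_0_iff) (use nn in auto)
  then have supp: "line_degree x = r" if "x \<in> V" "v x \<noteq> 0" for x using that by force
  then have "(\<Sum>z\<in>nbrs x. v z) = - r * v x" if "x \<in> V" for x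
    using adj[of x] that by (cases "v x = 0") auto
  then show ?thesis using that v(1) supp by blast
qed

text \<open>Otherwise the part \<open>K\<close> of the support in the closed neighbourhood of
  \<open>x\<close> is a clique that contains every support neighbour of its members, so the
  eigenvalue equation can be evaluated inside \<open>K\<close>.\<close>

lemma exists_support_pair:
  assumes nz: "\<exists>x\<in>V. v x \<noteq> 0" and eig: "\<And>x. x \<in> V \<Longrightarrow> (\<Sum>z\<in>nbrs x. v z) = - r * v x"
  shows "\<exists>x\<in>V. \<exists>y\<in>V. v x \<noteq> 0 \<and> v y \<noteq> 0 \<and> dst x y = 2"
proof (rule ccontr)
  assume no: "\<not> ?thesis"
  obtain x where x: "x \<in> V" "v x \<noteq> 0" using nz by blast
  define K where "K = {y \<in> V. v y \<noteq> 0 \<and> (y = x \<or> E x y)}"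
  have two: "y = w \<or> E y w" if "v y \<noteq> 0" "v w \<noteq> 0" "E y z" "E z w" for y z w
  proof -
    have V: "y \<in> V" "z \<in> V" "w \<in> V" using that edge_in by auto
    have "dst y w \<le> 2" using dst_step[OF V(1) that(4)] dst_eq_1[OF V(1,2)] that(3) by simp
    moreover have "dst y w \<noteq> 2" using no that V by blast
    ultimately have "dst y w = 0 \<or> dst y w = 1" by linarith
    then show ?thesis using dst_eq_0 dst_eq_1 V by blast
  qed
  have sumK: "(\<Sum>y\<in>K. v y) = (1 - r) * v z" if z: "z \<in> K" for z
  proof -
    have "(\<Sum>y\<in>nbrs z. v y) = (\<Sum>y\<in>K - {z}. v y)"
    proof (rule sum.mono_neutral_right)
      show "K - {z} \<subseteq> nbrs z"
      proof
        fix y assume y: "y \<in> K - {z}"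
        then have "z = y \<or> E z y"
          using two[of z y x] z edge_sym by (cases "y = x"; cases "z = x") (auto simp: K_def)
        then show "y \<in> nbrs z" using y by auto
      qed
      show "\<forall>y\<in>nbrs z - (K - {z}). v y = 0"
      proof (rule ballI, rule ccontr)
        fix y assume y: "y \<in> nbrs z - (K - {z})" "v y \<noteq> 0"
        then have "y \<in> K"
          using two[of x y z] z x edge_in by (cases "z = x") (auto simp: K_def)
        then show False using y by auto
      qed
    qed simp
    moreover have "finite K" by (simp add: K_def)
    moreover have "z \<in> V" using z by (simp add: K_def)
    ultimately show ?thesis using eig[of z] sum.remove[of K z v] z by (simp add: algebra_simps)
  qed
  have xK: "x \<in> K" using x by (simp add: K_def)
  \<comment> \<open>As \<open>1 - r\<close> is nonzero, \<open>v\<close> is constant on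
    \<open>K\<close>; comparing sums then gives \<open>K\<close> the negative size
    \<open>1 - r\<close>.\<close>
  have "v z = v x" if "z \<in> K" for z using sumK[OF that] sumK[OF xK] r_ge_7 by simp
  then have "(\<Sum>y\<in>K. v y) = card K * v x" by simp
  then have "card K = 1 - r" using sumK[OF xK] x by simp
  then show False using r_ge_7 by linarith
qed

text \<open>All lines through \<open>x\<close> attain the Delsarte bound, so each one near
  \<open>y\<close> carries \<open>1 + \<alpha>\<close> of the
  \<open>(1 + b) * (1 + \<alpha>)\<close> common neighbours of \<open>x\<close> and
  \<open>y\<close>; these shares are disjoint because lines meet only in \<open>x\<close>.\<close>

lemma card_near_lines:
  assumes xy: "x \<in> V" "y \<in> V" "dst x y = 2" and deg: "line_degree x = r"
  shows "card {l \<in> lines. x \<in> l \<and> (\<exists>z\<in>l. E y z)} = 1 + real_of_int b"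
    and "l \<in> lines \<Longrightarrow> x \<in> l \<Longrightarrow> \<exists>z\<in>l. E y z \<Longrightarrow> card {z \<in> l. E y z} = 1 + \<alpha>"
proof -
  let ?L = "{l \<in> lines. x \<in> l \<and> (\<exists>z\<in>l. E y z)}"
  have nadj: "\<not> E x y" "x \<noteq> y" using xy dst_eq_1[OF xy(1,2)] by auto
  then have nadj': "\<not> E y x" using edge_sym by blast
  have ynl: "y \<notin> l" if "l \<in> lines" "x \<in> l" for l using line_adj that nadj by blast
  show each: "card {z \<in> l. E y z} = 1 + \<alpha>" if "l \<in> lines" "x \<in> l" "\<exists>z\<in>l. E y z" for l
    using delsarte_clique_nbrs[OF line_clique[OF that(1)] card_line_eq[OF xy(1) deg that(1,2)] xy(2) ynl[OF that(1,2)] that(3)] .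
  have "{z \<in> nbrs y. Suc (dst x z) = dst x y} = (\<Union>l\<in>?L. {z \<in> l. E y z})"
  proof (intro set_eqI iffI)
    fix z assume z: "z \<in> {z \<in> nbrs y. Suc (dst x z) = dst x y}"
    then have "z \<in> V" using edge_in by blast
    then have "E x z" using z xy(3) dst_eq_1[OF xy(1)] by simp
    then obtain l where "l \<in> lines" "x \<in> l" "z \<in> l" using edge_on_line by blast
    then show "z \<in> (\<Union>l\<in>?L. {z \<in> l. E y z})" using z by blast
  next
    fix z assume "z \<in> (\<Union>l\<in>?L. {z \<in> l. E y z})"
    then obtain l where l: "l \<in> lines" "x \<in> l" "z \<in> l" "E y z" by blast
    then have "E x z" using line_adj nadj' by blast
    then show "z \<in> {z \<in> nbrs y. Suc (dst x z) = dst x y}"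
      using l(4) xy(3) dst_eq_1[OF xy(1) edge_in(2)] by simp
  qed
  then have "real (ci 2) = card (\<Union>l\<in>?L. {z \<in> l. E y z})"
    using card_nbrs_inner[OF xy(1,2)] xy(3) by (simp add: cc_def)
  also have "\<dots> = (\<Sum>l\<in>?L. card {z \<in> l. E y z})"
  proof -
    have "card (\<Union>l\<in>?L. {z \<in> l. E y z}) = (\<Sum>l\<in>?L. card {z \<in> l. E y z})"
    proof (rule card_UN_disjoint)
      show "\<forall>l\<in>?L. \<forall>l'\<in>?L. l \<noteq> l' \<longrightarrow> {z \<in> l. E y z} \<inter> {z \<in> l'. E y z} = {}"
        using lines_meet[of _ _ x] nadj' by blast
    qed (auto simp: finite_lines finite_line)
    then show ?thesis by simp
  qed
  also have "\<dots> = (\<Sum>l\<in>?L. 1 + \<alpha>)" using each by simp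
  finally have "(1 + b) * (1 + \<alpha>) = card ?L * (1 + \<alpha>)" using ci_2 by simp
  then show "card ?L = 1 + real_of_int b" using alpha_nonneg by simp
qed

text \<open>As \<open>1 + \<alpha>\<close> is a cardinality, \<alpha> is an integer. Joining
  \<open>y\<close> to its \<open>1 + \<alpha>\<close> neighbours on a line through \<open>x\<close>
  gives as many lines through \<open>y\<close> near \<open>x\<close>; only \<open>1 + b\<close> of
  these exist, since \<open>y\<close> also lies in the support.\<close>

lemma alpha_integer_le_b: "\<alpha> \<in> \<int> \<and> \<alpha> \<le> real_of_int b"
proof -
  obtain v where v: "\<exists>x\<in>V. v x \<noteq> 0" "\<And>x. x \<in> V \<Longrightarrow> v x \<noteq> 0 \<Longrightarrow> line_degree x = r"
    "\<And>x. x \<in> V \<Longrightarrow> (\<Sum>z\<in>nbrs x. v z) = - r * v x"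
    by (rule exists_line_free_vector) (rule that, assumption+)
  obtain x y where xy: "x \<in> V" "y \<in> V" "dst x y = 2" and deg: "line_degree x = r" "line_degree y = r"
    using exists_support_pair[OF v(1,3)] v(2) by blast
  have yx: "dst y x = 2" using xy(3) dst_commute by simp
  have nadj: "\<not> E x y" "x \<noteq> y" using xy dst_eq_1[OF xy(1,2)] by auto
  then have nadj': "\<not> E y x" using edge_sym by blast
  have "{l \<in> lines. x \<in> l \<and> (\<exists>z\<in>l. E y z)} \<noteq> {}" (is "?L \<noteq> {}")
  proof
    assume "?L = {}"
    then have "card ?L = 0" by (simp only: card.empty)
    then show False using card_near_lines(1)[OF xy deg(1)] b_ge by linarith
  qed
  then obtain l where l: "l \<in> lines" "x \<in> l" "\<exists>z\<in>l. E y z" by blast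
  let ?N = "{z \<in> l. E y z}"
  have N: "real (card ?N) = 1 + \<alpha>" by (rule card_near_lines(2)[OF xy deg(1) l])
  have "\<alpha> = of_int (int (card ?N) - 1)" using N by simp
  then have int: "\<alpha> \<in> \<int>" by (metis Ints_of_int)
  have "\<forall>z\<in>?N. \<exists>m\<in>lines. y \<in> m \<and> z \<in> m" using edge_on_line by blast
  then obtain g where g: "\<And>z. z \<in> ?N \<Longrightarrow> g z \<in> lines \<and> y \<in> g z \<and> z \<in> g z" by metis
  have ynl: "y \<notin> l" using line_adj l nadj by blast
  \<comment> \<open>Two of these points on one line through \<open>y\<close> would identify it with
    \<open>l\<close>, which misses \<open>y\<close>.\<close>
  have "inj_on g ?N"
  proof (rule inj_onI, rule ccontr)
    fix z w assume zw: "z \<in> ?N" "w \<in> ?N" "g z = g w" "z \<noteq> w"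
    then have "g z = l" using lines_meet[of "g z" l z w] g[OF zw(1)] g[OF zw(2)] l(1) by simp
    then show False using g[OF zw(1)] ynl by simp
  qed
  moreover have "g ` ?N \<subseteq> {m \<in> lines. y \<in> m \<and> (\<exists>z\<in>m. E x z)}"
  proof
    fix m assume "m \<in> g ` ?N"
    then obtain z where z: "z \<in> ?N" "m = g z" by blast
    have "E x z" using line_adj[OF l(1,2)] z(1) nadj' by blast
    then show "m \<in> {m \<in> lines. y \<in> m \<and> (\<exists>z\<in>m. E x z)}" using g[OF z(1)] z(2) by blast
  qed
  ultimately have "card ?N \<le> card {m \<in> lines. y \<in> m \<and> (\<exists>z\<in>m. E x z)}"
    by (intro card_inj_on_le) (auto simp: finite_lines)
  then have "real (card ?N) \<le> 1 + real_of_int b"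
    using card_near_lines(1)[OF xy(2,1) yx deg(2)] by linarith
  then show ?thesis using N int by simp
qed

end

theorem theorem14:
  fixes V :: "'a set" and E :: "'a \<Rightarrow> 'a \<Rightarrow> bool"
    and D :: nat and bi ci :: "nat \<Rightarrow> nat" and b :: int and \<alpha> \<beta> :: real
  assumes "distance_regular V E D bi ci"
    and "classical_parameters bi ci D b \<alpha> \<beta>"
    and "b \<ge> 2" and "D \<ge> 3"
    and "\<beta> \<ge> (1/3) * (8 * \<alpha> * b + 8 * b + 5 * \<alpha>) * qnum b D"
  shows "SPLS V E bi ci (ci 2) (nat \<lfloor>4 * qnum b D / 3\<rfloor>)
         \<and> \<alpha> \<in> \<int> \<and> 0 \<le> \<alpha> \<and> \<alpha> \<le> real_of_int b"
proof -
  interpret classical_drg V E D bi ci b \<alpha> \<beta>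
    using assms by unfold_locales
  show ?thesis using SPLS alpha_nonneg alpha_integer_le_b by blast
qed

end
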